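(* Let $G$ be a finite simple co-chordal graph on $[n]=\{1,\dots,n\}$ with at least one edge, let $\mathbb K$ be a field, let $s\ge 1$ be an integer, and put $J=I(G)^{(s)}\subseteq S=\mathbb K[x_1,\dots,x_n]$. Then the following hold. (i) $J_{\langle d\rangle}=0$ for every $d\le s$. (ii) $J_{\langle s+1\rangle}$ is either zero or has an $(s+1)$-linear resolution. (iii) $J_{\langle d\rangle}$ has a $d$-linear resolution for every $d\ge 2s$. Thus every integer $d\ge 0$ not covered by (i)--(iii) satisfies $s+2\le d\le 2s-1$, and this interval is nonempty only for $s\ge 3$.
   Context: $S$ is standard graded. A graph is chordal if it has no induced cycle of length at least $4$; $G$ is co-chordal if its complement $G^c$ is chordal. The edge ideal is $I(G)=(x_ix_j:\{i,j\}\in E(G))$, and $I(G)^{(s)}=\bigcap_{C}P_C^s$, where $C$ runs over the minimal vertex covers of $G$ and $P_C=(x_i:i\in C)$. For a monomial ideal $L\subseteq S$ and an integer $d\ge 0$, $L_d$ is the degree $d$ component of $L$ and $L_{\langle d\rangle}$ is the ideal of $S$ generated by $L_d$. A nonzero homogeneous ideal $L$ has a $d$-linear resolution if $\beta_{i,j}(L)=\dim_{\mathbb K}\operatorname{Tor}_i^S(L,\mathbb K)_j=0$ whenever $j\ne i+d$. *)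

theory Defs
  imports Complex_Main "HOL-Library.Poly_Mapping" "HOL-Library.Function_Algebras"
begin

section \<open>Graphs\<close>

text \<open>A graph on the vertex set \<open>UNIV :: 'v set\<close> is its set of edges, which are two-element sets
  of vertices.\<close>

definition simple_graph :: "'v set set \<Rightarrow> bool" where
  "simple_graph E \<longleftrightarrow> (\<forall>e\<in>E. card e = 2)"

definition complement_graph :: "'v set set \<Rightarrow> 'v set set" where
  "complement_graph E = {e. card e = 2} - E"

definition induced_cycle :: "'v set set \<Rightarrow> 'v list \<Rightarrow> bool" where
  "induced_cycle E vs \<longleftrightarrow> 3 \<le> length vs \<and> distinct vs \<and>
     (\<forall>i<length vs. \<forall>j<length vs.
        {vs ! i, vs ! j} \<in> E \<longleftrightarrow> j = Suc i mod length vs \<or> i = Suc j mod length vs)"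

definition chordal :: "'v set set \<Rightarrow> bool" where
  "chordal E \<longleftrightarrow> \<not> (\<exists>vs. induced_cycle E vs \<and> 4 \<le> length vs)"

definition co_chordal :: "'v set set \<Rightarrow> bool" where
  "co_chordal E \<longleftrightarrow> chordal (complement_graph E)"

definition vertex_cover :: "'v set set \<Rightarrow> 'v set \<Rightarrow> bool" where
  "vertex_cover E C \<longleftrightarrow> (\<forall>e\<in>E. e \<inter> C \<noteq> {})"

definition minimal_vertex_cover :: "'v set set \<Rightarrow> 'v set \<Rightarrow> bool" where
  "minimal_vertex_cover E C \<longleftrightarrow> vertex_cover E C \<and> (\<forall>D. D \<subset> C \<longrightarrow> \<not> vertex_cover E D)"


section \<open>The polynomial ring and its ideals\<close>

text \<open>Exponent vectors are finitely supported functions, and a polynomial is a finitely supported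
  function from exponent vectors to coefficients; the product of \<open>Poly_Mapping\<close> is then the product
  of polynomials. The variables are indexed by \<open>'v\<close>, so this is \<open>K[x\<^sub>v : v \<in> UNIV]\<close>.\<close>

type_synonym ('v, 'k) mpoly = "('v \<Rightarrow>\<^sub>0 nat) \<Rightarrow>\<^sub>0 'k"

definition var :: "'v \<Rightarrow> ('v, 'k::field) mpoly" where
  "var v = Poly_Mapping.single (Poly_Mapping.single v 1) 1"

text \<open>A commutative ring as a module over itself: submodules are the ideals, and the span of a set
  is the ideal generated by it.\<close>

lemma module_mult: "module ((*) :: 'a::comm_ring_1 \<Rightarrow> 'a \<Rightarrow> 'a)"
  by standard (simp_all add: algebra_simps)

abbreviation ideal_span :: "'a::comm_ring_1 set \<Rightarrow> 'a set" where
  "ideal_span \<equiv> module.span (*)"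

abbreviation is_ideal :: "'a::comm_ring_1 set \<Rightarrow> bool" where
  "is_ideal \<equiv> module.subspace (*)"

fun ideal_power :: "'a::comm_ring_1 set \<Rightarrow> nat \<Rightarrow> 'a set" where
  "ideal_power I 0 = UNIV"
| "ideal_power I (Suc s) = ideal_span {a * b |a b. a \<in> I \<and> b \<in> ideal_power I s}"

definition cover_ideal_prime :: "'v set \<Rightarrow> ('v, 'k::field) mpoly set" where
  "cover_ideal_prime C = ideal_span (var ` C)"

text \<open>The symbolic power \<open>I(G)\<^sup>(\<^sup>s\<^sup>)\<close> of the edge ideal.\<close>

definition symbolic_power :: "'v set set \<Rightarrow> nat \<Rightarrow> ('v, 'k::field) mpoly set" where
  "symbolic_power E s = (\<Inter>C\<in>{C. minimal_vertex_cover E C}. ideal_power (cover_ideal_prime C) s)"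


section \<open>The standard grading\<close>

definition mdegree :: "('v::finite \<Rightarrow>\<^sub>0 nat) \<Rightarrow> nat" where
  "mdegree m = (\<Sum>v\<in>UNIV. Poly_Mapping.lookup m v)"

text \<open>The zero polynomial is homogeneous of every degree.\<close>

definition homogeneous :: "nat \<Rightarrow> ('v::finite, 'k::field) mpoly \<Rightarrow> bool" where
  "homogeneous d p \<longleftrightarrow> (\<forall>m\<in>Poly_Mapping.keys p. mdegree m = d)"

definition degree_part :: "('v::finite, 'k::field) mpoly set \<Rightarrow> nat \<Rightarrow> ('v, 'k) mpoly set" where
  "degree_part L d = {p \<in> L. homogeneous d p}"

definition degree_ideal :: "('v::finite, 'k::field) mpoly set \<Rightarrow> nat \<Rightarrow> ('v, 'k) mpoly set" where
  "degree_ideal L d = ideal_span (degree_part L d)"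

definition homogeneous_ideal :: "('v::finite, 'k::field) mpoly set \<Rightarrow> bool" where
  "homogeneous_ideal L \<longleftrightarrow> is_ideal L \<and> L = ideal_span (\<Union>d. degree_part L d)"


section \<open>Graded free resolutions, Tor and graded Betti numbers\<close>

text \<open>Elements of the free module of rank \<open>r\<close> are functions on \<open>nat\<close> that vanish outside
  \<open>{..<r}\<close>; \<open>mat_app m n M\<close> is multiplication by the \<open>m \<times> n\<close> matrix \<open>M\<close>.\<close>

definition free_module :: "nat \<Rightarrow> (nat \<Rightarrow> 'a::comm_ring_1) set" where
  "free_module r = {v. \<forall>k\<ge>r. v k = 0}"

definition mat_app ::
  "nat \<Rightarrow> nat \<Rightarrow> (nat \<Rightarrow> nat \<Rightarrow> 'a::comm_ring_1) \<Rightarrow> (nat \<Rightarrow> 'a) \<Rightarrow> nat \<Rightarrow> 'a" where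
  "mat_app m n M v = (\<lambda>k. if k < m then \<Sum>l<n. M k l * v l else 0)"

text \<open>A complex \<open>\<dots> \<rightarrow> F\<^sub>2 \<rightarrow> F\<^sub>1 \<rightarrow> F\<^sub>0 \<rightarrow> S\<close>, where \<open>F\<^sub>i\<close> is the direct sum of the modules
  \<open>S(- gen_deg i k)\<close> for \<open>k < frank i\<close>. Column \<open>l\<close> of the matrix \<open>diff i\<close> is the image in \<open>F\<^sub>i\<close> of
  the \<open>l\<close>-th basis element of \<open>F\<^sub>i\<^sub>+\<^sub>1\<close>, and \<open>aug l\<close> is the image in \<open>S\<close> of the \<open>l\<close>-th basis element
  of \<open>F\<^sub>0\<close>.\<close>

record 'p free_complex =
  frank :: "nat \<Rightarrow> nat"
  gen_deg :: "nat \<Rightarrow> nat \<Rightarrow> int"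
  aug :: "nat \<Rightarrow> 'p"
  diff :: "nat \<Rightarrow> nat \<Rightarrow> nat \<Rightarrow> 'p"

definition aug_map :: "('v, 'k::field) mpoly free_complex \<Rightarrow> (nat \<Rightarrow> ('v, 'k) mpoly) \<Rightarrow> ('v, 'k) mpoly" where
  "aug_map F v = (\<Sum>l<frank F 0. aug F l * v l)"

definition diff_map ::
  "('v, 'k::field) mpoly free_complex \<Rightarrow> nat \<Rightarrow> (nat \<Rightarrow> ('v, 'k) mpoly) \<Rightarrow> nat \<Rightarrow> ('v, 'k) mpoly" where
  "diff_map F i = mat_app (frank F i) (frank F (Suc i)) (diff F i)"

text \<open>The first two conditions say that the maps are homogeneous of degree 0.\<close>

definition graded_free_resolution ::
  "('v::finite, 'k::field) mpoly free_complex \<Rightarrow> ('v, 'k) mpoly set \<Rightarrow> bool" where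
  "graded_free_resolution F L \<longleftrightarrow>
     (\<forall>l<frank F 0. \<forall>m\<in>Poly_Mapping.keys (aug F l). int (mdegree m) = gen_deg F 0 l) \<and>
     (\<forall>i. \<forall>k<frank F i. \<forall>l<frank F (Suc i). \<forall>m\<in>Poly_Mapping.keys (diff F i k l).
        gen_deg F i k + int (mdegree m) = gen_deg F (Suc i) l) \<and>
     aug_map F ` free_module (frank F 0) = L \<and>
     {v \<in> free_module (frank F 0). aug_map F v = 0} = diff_map F 0 ` free_module (frank F 1) \<and>
     (\<forall>i. {v \<in> free_module (frank F (Suc i)). diff_map F i v = 0}
            = diff_map F (Suc i) ` free_module (frank F (Suc (Suc i))))"

text \<open>The complex of \<open>K\<close>-vector spaces obtained by tensoring with \<open>K = S/(x\<^sub>v : v)\<close>, that is, by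
  keeping the constant coefficients of the matrices, in internal degree \<open>j\<close>.\<close>

definition tor_chains :: "('v, 'k::field) mpoly free_complex \<Rightarrow> nat \<Rightarrow> int \<Rightarrow> (nat \<Rightarrow> 'k) set" where
  "tor_chains F i j = {v \<in> free_module (frank F i). \<forall>k<frank F i. v k \<noteq> 0 \<longrightarrow> gen_deg F i k = j}"

definition tor_diff :: "('v, 'k::field) mpoly free_complex \<Rightarrow> nat \<Rightarrow> (nat \<Rightarrow> 'k) \<Rightarrow> nat \<Rightarrow> 'k" where
  "tor_diff F i =
     mat_app (frank F i) (frank F (Suc i)) (\<lambda>k l. Poly_Mapping.lookup (diff F i k l) 0)"

fun tor_cycles :: "('v, 'k::field) mpoly free_complex \<Rightarrow> nat \<Rightarrow> int \<Rightarrow> (nat \<Rightarrow> 'k) set" where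
  "tor_cycles F 0 j = tor_chains F 0 j"
| "tor_cycles F (Suc i) j = {v \<in> tor_chains F (Suc i) j. tor_diff F i v = 0}"

definition tor_boundaries :: "('v, 'k::field) mpoly free_complex \<Rightarrow> nat \<Rightarrow> int \<Rightarrow> (nat \<Rightarrow> 'k) set" where
  "tor_boundaries F i j = tor_diff F i ` tor_chains F (Suc i) j"

lemma vector_space_fun: "vector_space (\<lambda>(c::'k::field) (v::nat \<Rightarrow> 'k) k. c * v k)"
  by standard (simp_all add: fun_eq_iff plus_fun_def algebra_simps)

abbreviation fun_dim :: "(nat \<Rightarrow> 'k::field) set \<Rightarrow> nat" where
  "fun_dim \<equiv> vector_space.dim (\<lambda>c v k. c * v k)"

text \<open>For a resolution the boundaries lie in the cycles and both are finite-dimensional, so this is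
  the dimension of the quotient.\<close>

definition tor_dim :: "('v, 'k::field) mpoly free_complex \<Rightarrow> nat \<Rightarrow> int \<Rightarrow> nat" where
  "tor_dim F i j = fun_dim (tor_cycles F i j) - fun_dim (tor_boundaries F i j)"

text \<open>The dimension of \<open>Tor\<^sub>i(L, K)\<^sub>j\<close>. Every homogeneous ideal has a resolution of this kind (with
  all ranks finite) by noetherianity, and \<open>tor_dim F i j\<close> is the same for all resolutions \<open>F\<close> of \<open>L\<close>;
  \<open>LEAST\<close> merely picks out this common value.\<close>

definition betti ::
  "('v::finite, 'k::field) mpoly set \<Rightarrow> nat \<Rightarrow> int \<Rightarrow> nat" where
  "betti L i j = (LEAST b. \<exists>F. graded_free_resolution F L \<and> b = tor_dim F i j)"

definition has_linear_resolution :: "('v::finite, 'k::field) mpoly set \<Rightarrow> nat \<Rightarrow> bool" where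
  "has_linear_resolution L d \<longleftrightarrow> homogeneous_ideal L \<and> L \<noteq> {0} \<and>
     (\<forall>i j. j \<noteq> int i + int d \<longrightarrow> betti L i j = 0)"

end

theory Submission
  imports Defs
begin

text \<open>Let \<open>H\<close> be the complement of \<open>G\<close>, with a perfect elimination order (Dirac), and for a vertex
  \<open>z\<close> let \<open>bag z\<close> be the clique consisting of \<open>z\<close> and its later neighbours. Every clique of \<open>H\<close> lies
  in a bag, so \<open>J\<close> is spanned by the monomials of weight at least \<open>s\<close> outside of each bag. In degree
  at most \<open>s\<close> there are none, and in degree \<open>s + 1\<close> they are the squarefree monomials on the
  independent sets of \<open>H\<close>.

  Linear quotients of \<open>L\<^bsub>d\<^esub>\<close> are built by splitting on a variable \<open>x\<close>: first \<open>x (L : x)\<^bsub>d-1\<^esub>\<close>, then the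
  monomials of \<open>L\<^bsub>d\<^esub>\<close> without \<open>x\<close>. This works when \<open>L : x\<close> is generated in degrees below \<open>d\<close>. For
  \<open>d \<ge> 2 s\<close> one splits on the vertices in elimination order until a monomial \<open>\<alpha>\<close> of degree \<open>s\<close> has
  been divided out. The remaining constraints on a monomial \<open>w\<close> of degree \<open>d - s \<ge> s\<close> in the variables
  \<open>U\<close> not yet eliminated, \<open>w(U - bag z) \<ge> \<alpha>(bag z)\<close>, are indexed by a forest along which \<open>U - bag z\<close>
  decreases towards the roots. Here the sum of the increases of the bounds along the edges of the
  forest is at most \<open>s\<close>, and this sum bounds the regularity: it drops whenever one divides by a
  variable occurring in a topmost nontrivial constraint.

  Linear quotients yield a linear resolution by iterating syzygies. The leading coordinate ideals
  of the syzygies are generated by variables, and this property passes to the syzygies of the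
  syzygies.\<close>

section \<open>Monomial ideals\<close>

lemma module_vec: "module (\<lambda>(c::'a::comm_ring_1) (v::nat \<Rightarrow> 'a) k. c * v k)"
  by standard (simp_all add: fun_eq_iff plus_fun_def algebra_simps)

lemmas ideal_subspaceI = module.subspaceI[OF module_mult]
  and ideal_span_minimal = module.span_minimal[OF module_mult]
  and ideal_span_base = module.span_base[OF module_mult]
  and ideal_span_zero = module.span_zero[OF module_mult]
  and ideal_span_scale = module.span_scale[OF module_mult]
  and ideal_span_neg = module.span_neg[OF module_mult]
  and ideal_span_sum = module.span_sum[OF module_mult]

abbreviation "lookup \<equiv> Poly_Mapping.lookup"
abbreviation "keys \<equiv> Poly_Mapping.keys"

abbreviation monom :: "('v \<Rightarrow>\<^sub>0 nat) \<Rightarrow> ('v, 'k::field) mpoly" where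
  "monom m \<equiv> Poly_Mapping.single m 1"

lemma var_eq_monom: "var v = monom (Poly_Mapping.single v 1)"
  by (simp add: var_def)

lemma var_image_eq: "var ` V = monom ` ((\<lambda>x. Poly_Mapping.single x 1) ` V)"
  by (auto simp: var_eq_monom)

lemma lookup_add_single:
  "lookup (m + Poly_Mapping.single x c) y = lookup m y + (if x = y then c else 0)"
  by (simp add: lookup_add lookup_single when_def)

lemma poly_mapping_sum_monomials: "(\<Sum>u\<in>keys p. Poly_Mapping.single u (lookup p u)) = p"
proof (rule poly_mapping_eqI)
  fix v
  have "lookup (\<Sum>u\<in>keys p. Poly_Mapping.single u (lookup p u)) v
      = (\<Sum>u\<in>keys p. if v = u then lookup p u else 0)"
    by (simp add: lookup_sum lookup_single when_def eq_commute)
  also have "\<dots> = lookup p v" by (simp add: sum.delta' in_keys_iff)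
  finally show "lookup (\<Sum>u\<in>keys p. Poly_Mapping.single u (lookup p u)) v = lookup p v" .
qed

lemma lookup_times_monom:
  fixes p :: "('v, 'k::field) mpoly"
  shows "lookup (p * monom m) (u + m) = lookup p u"
proof -
  have "p * monom m = (\<Sum>k\<in>keys p. Poly_Mapping.single k (lookup p k)) * monom m"
    by (simp add: poly_mapping_sum_monomials)
  also have "\<dots> = (\<Sum>k\<in>keys p. Poly_Mapping.single (k + m) (lookup p k))"
    by (simp add: sum_distrib_right mult_single)
  finally have "lookup (p * monom m) (u + m) = (\<Sum>k\<in>keys p. lookup p k when k = u)"
    by (simp add: lookup_sum lookup_single)
  also have "\<dots> = lookup p u"
    by (auto simp: when_def sum.delta in_keys_iff)
  finally show ?thesis .
qed

lemma keys_times_monom: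
  fixes p :: "('v, 'k::field) mpoly"
  shows "keys (p * monom m) = (\<lambda>u. u + m) ` keys p"
proof
  show "keys (p * monom m) \<subseteq> (\<lambda>u. u + m) ` keys p"
    using keys_mult[of p "monom m"] by (auto split: if_splits)
  show "(\<lambda>u. u + m) ` keys p \<subseteq> keys (p * monom m)"
    by (auto simp: in_keys_iff lookup_times_monom)
qed

text \<open>The right-hand side defines an ideal containing the generators; conversely, a polynomial
  is the sum of its terms, each of them a multiple of a generator.\<close>

lemma ideal_span_monom:
  fixes p :: "('v, 'k::field) mpoly"
  shows "p \<in> ideal_span (monom ` A) \<longleftrightarrow> (\<forall>u\<in>keys p. \<exists>a\<in>A. \<exists>b. u = b + a)"
proof
  have "ideal_span (monom ` A) \<subseteq> {p :: ('v, 'k) mpoly. \<forall>u\<in>keys p. \<exists>a\<in>A. \<exists>b. u = b + a}"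
  proof (rule ideal_span_minimal)
    show "monom ` A \<subseteq> {p :: ('v, 'k) mpoly. \<forall>u\<in>keys p. \<exists>a\<in>A. \<exists>b. u = b + a}"
      by (auto intro!: bexI exI[of _ 0])
    show "is_ideal {p :: ('v, 'k) mpoly. \<forall>u\<in>keys p. \<exists>a\<in>A. \<exists>b. u = b + a}"
    proof (rule ideal_subspaceI)
      fix c q :: "('v, 'k) mpoly"
      assume q: "q \<in> {p. \<forall>u\<in>keys p. \<exists>a\<in>A. \<exists>b. u = b + a}"
      show "c * q \<in> {p. \<forall>u\<in>keys p. \<exists>a\<in>A. \<exists>b. u = b + a}"
      proof (intro CollectI ballI)
        fix u assume "u \<in> keys (c * q)"
        then obtain v w where "u = v + w" "w \<in> keys q"
          using keys_mult[of c q] by blast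
        moreover then obtain a b where "a \<in> A" "w = b + a" using q by blast
        ultimately show "\<exists>a\<in>A. \<exists>b. u = b + a" by (metis add.assoc)
      qed
    next
      fix q r :: "('v, 'k) mpoly"
      assume "q \<in> {p. \<forall>u\<in>keys p. \<exists>a\<in>A. \<exists>b. u = b + a}" "r \<in> {p. \<forall>u\<in>keys p. \<exists>a\<in>A. \<exists>b. u = b + a}"
      then show "q + r \<in> {p. \<forall>u\<in>keys p. \<exists>a\<in>A. \<exists>b. u = b + a}"
        using keys_add[of q r] by blast
    qed simp
  qed
  then show "\<forall>u\<in>keys p. \<exists>a\<in>A. \<exists>b. u = b + a" if "p \<in> ideal_span (monom ` A)"
    using that by blast
  assume *: "\<forall>u\<in>keys p. \<exists>a\<in>A. \<exists>b. u = b + a"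
  have "(\<Sum>u\<in>keys p. Poly_Mapping.single u (lookup p u)) \<in> ideal_span (monom ` A)"
  proof (rule ideal_span_sum)
    fix u assume "u \<in> keys p"
    then obtain a b where "a \<in> A" "u = b + a" using * by blast
    then have "Poly_Mapping.single u (lookup p u)
      = Poly_Mapping.single b (lookup p u) * (monom a :: ('v, 'k) mpoly)"
      by (simp add: mult_single)
    then show "Poly_Mapping.single u (lookup p u) \<in> ideal_span (monom ` A)"
      using \<open>a \<in> A\<close> by (auto intro: ideal_span_scale ideal_span_base)
  qed
  then show "p \<in> ideal_span (monom ` A)" by (simp add: poly_mapping_sum_monomials)
qed

lemma ideal_span_var:
  fixes p :: "('v, 'k::field) mpoly"
  shows "p \<in> ideal_span (var ` V) \<longleftrightarrow> (\<forall>u\<in>keys p. \<exists>x\<in>V. lookup u x > 0)"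
proof -
  have "(\<exists>b. u = b + Poly_Mapping.single x 1) \<longleftrightarrow> lookup u x > 0" for u :: "'v \<Rightarrow>\<^sub>0 nat" and x
  proof
    assume "lookup u x > 0"
    then have "u = (u - Poly_Mapping.single x 1) + Poly_Mapping.single x 1"
      by (intro poly_mapping_eqI) (auto simp: lookup_add_single lookup_minus lookup_single when_def)
    then show "\<exists>b. u = b + Poly_Mapping.single x 1" by blast
  qed (auto simp: lookup_add_single)
  then show ?thesis
    unfolding var_image_eq ideal_span_monom by simp
qed

lemma sum_keys_split:
  fixes p :: "('v, 'k::field) mpoly"
  assumes "finite V" and h: "\<And>u. u \<in> keys p \<Longrightarrow> h u \<in> V"
  shows "p = (\<Sum>x\<in>V. \<Sum>u\<in>{u \<in> keys p. h u = x}. Poly_Mapping.single u (lookup p u))"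
proof -
  have "(\<Sum>x\<in>V. \<Sum>u\<in>{u \<in> keys p. h u = x}. Poly_Mapping.single u (lookup p u))
      = (\<Sum>u\<in>keys p. Poly_Mapping.single u (lookup p u))"
    by (rule sum.group) (use assms in auto)
  then show ?thesis by (simp add: poly_mapping_sum_monomials)
qed

lemma keys_sum_single:
  assumes "finite A"
  shows "keys (\<Sum>u\<in>A. Poly_Mapping.single (g u) (c u)) \<subseteq> g ` A"
  using keys_sum[of "\<lambda>u. Poly_Mapping.single (g u) (c u)" A] by (auto split: if_splits)

text \<open>In particular, the coefficients are homogeneous whenever the polynomial is.\<close>

lemma ideal_span_var_coefficients:
  fixes p :: "('v, 'k::field) mpoly"
  assumes "finite V" and p: "p \<in> ideal_span (var ` V)"
  obtains a where "p = (\<Sum>x\<in>V. a x * var x)"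
    and "\<And>x u. u \<in> keys (a x) \<Longrightarrow> u + Poly_Mapping.single x 1 \<in> keys p"
proof -
  have "\<forall>u\<in>keys p. \<exists>x\<in>V. lookup u x > 0" using p by (simp add: ideal_span_var)
  then obtain h where h: "\<And>u. u \<in> keys p \<Longrightarrow> h u \<in> V \<and> lookup u (h u) > 0" by metis
  let ?e = "\<lambda>x. Poly_Mapping.single x (1::nat)"
  have e: "u - ?e (h u) + ?e (h u) = u" if "u \<in> keys p" for u
    using h[OF that] by (intro poly_mapping_eqI) (auto simp: lookup_add_single lookup_minus lookup_single when_def)
  \<comment> \<open>Every term of \<open>p\<close> is assigned to one variable \<open>h u\<close>
    dividing it. The summands \<open>a x * var x\<close> then have disjoint supports, which controls
    the keys of \<open>a x\<close>.\<close>
  define a where "a x = (\<Sum>u\<in>{u \<in> keys p. h u = x}. Poly_Mapping.single (u - ?e x) (lookup p u))" for x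
  show ?thesis
  proof
    have "a x * var x = (\<Sum>u\<in>{u \<in> keys p. h u = x}. Poly_Mapping.single u (lookup p u))" for x
      unfolding a_def var_eq_monom sum_distrib_right
      by (intro sum.cong refl) (use e in \<open>auto simp: mult_single\<close>)
    then show "p = (\<Sum>x\<in>V. a x * var x)"
      using sum_keys_split[of V p h] h \<open>finite V\<close> by simp
  next
    fix x u assume "u \<in> keys (a x)"
    then obtain w where "w \<in> keys p" "h w = x" "u = w - ?e x"
      unfolding a_def using keys_sum_single[of "{u \<in> keys p. h u = x}" "\<lambda>u. u - ?e x"] by fastforce
    then show "u + ?e x \<in> keys p" using e[of w] by auto
  qed
qed

text \<open>The ideal generated by the variables in \<open>V\<close> is prime and does not contain
  \<open>var x\<close>: multiplication by \<open>var x\<close> leaves the exponents at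
  \<open>V\<close> unchanged.\<close>

lemma ideal_span_var_times_var:
  fixes c :: "('v, 'k::field) mpoly"
  assumes "c * var x \<in> ideal_span (var ` V)" "x \<notin> V"
  shows "c \<in> ideal_span (var ` V)"
  unfolding ideal_span_var
proof
  fix u assume "u \<in> keys c"
  then have "u + Poly_Mapping.single x 1 \<in> keys (c * var x)"
    by (auto simp: var_eq_monom keys_times_monom)
  then obtain y where "y \<in> V" "lookup (u + Poly_Mapping.single x 1) y > 0"
    using assms(1) unfolding ideal_span_var by blast
  then show "\<exists>y\<in>V. lookup u y > 0" using assms(2) by (auto simp: lookup_add_single split: if_splits)
qed

section \<open>Degrees and homogeneous polynomials\<close>

lemma mdegree_add: "mdegree (a + b) = mdegree a + mdegree b"
  by (simp add: mdegree_def lookup_add sum.distrib)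

lemma mdegree_single [simp]: "mdegree (Poly_Mapping.single x c) = c"
  by (simp add: mdegree_def lookup_single when_def sum.delta)

lemma homogeneous_zero [simp]: "homogeneous d 0"
  by (simp add: homogeneous_def)

lemma homogeneous_var [simp]: "homogeneous 1 (var x)" "homogeneous (Suc 0) (var x)"
  by (simp_all add: homogeneous_def var_eq_monom)

lemma homogeneous_add: "homogeneous d p \<Longrightarrow> homogeneous d q \<Longrightarrow> homogeneous d (p + q)"
  using keys_add[of p q] by (auto simp: homogeneous_def)

lemma homogeneous_uminus: "homogeneous d p \<Longrightarrow> homogeneous d (- p)"
  by (simp add: homogeneous_def)

lemma homogeneous_diff: "homogeneous d p \<Longrightarrow> homogeneous d q \<Longrightarrow> homogeneous d (p - q)"
  using homogeneous_add[of d p "- q"] homogeneous_uminus[of d q] by simp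

lemma homogeneous_mult: "homogeneous d p \<Longrightarrow> homogeneous e q \<Longrightarrow> homogeneous (d + e) (p * q)"
  using keys_mult[of p q] by (fastforce simp: homogeneous_def mdegree_add)

lemma homogeneous_sum: "(\<And>x. x \<in> A \<Longrightarrow> homogeneous d (f x)) \<Longrightarrow> homogeneous d (sum f A)"
  by (induction A rule: infinite_finite_induct) (auto intro: homogeneous_add)


section \<open>Syzygies with linear leading coordinates\<close>

lemmas submoduleI = module.subspaceI[OF module_vec]
  and submodule_sum = module.subspace_sum[OF module_vec]
  and submodule_scale = module.subspace_scale[OF module_vec]
  and submodule_diff = module.subspace_diff[OF module_vec]

abbreviation submodule :: "(nat \<Rightarrow> 'a::comm_ring_1) set \<Rightarrow> bool" where
  "submodule \<equiv> module.subspace (\<lambda>c v k. c * v k)"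

lemma sum_fun_eval: "(\<Sum>a\<in>A. f a) x = (\<Sum>a\<in>A. f a x)"
  by (induction A rule: infinite_finite_induct) auto

lemma mat_app_add: "mat_app m n M (u + v) = mat_app m n M u + mat_app m n M v"
  by (simp add: mat_app_def plus_fun_def distrib_left sum.distrib fun_eq_iff)

lemma mat_app_scale: "mat_app m n M (\<lambda>k. c * v k) = (\<lambda>k. c * mat_app m n M v k)"
  by (simp add: mat_app_def sum_distrib_left mult.left_commute fun_eq_iff)

lemma mat_app_zero: "mat_app m n M 0 = 0"
  by (simp add: mat_app_def fun_eq_iff)

lemma submodule_kernel:
  fixes M :: "nat \<Rightarrow> nat \<Rightarrow> 'a::comm_ring_1"
  shows "submodule {v \<in> free_module n. mat_app m n M v = 0}"
proof (rule submoduleI)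
  show "(\<lambda>k. c * v k) \<in> {v \<in> free_module n. mat_app m n M v = 0}"
    if "v \<in> {v \<in> free_module n. mat_app m n M v = 0}" for c v
    using that by (simp add: mat_app_scale free_module_def fun_eq_iff)
next
  show "u + v \<in> {v \<in> free_module n. mat_app m n M v = 0}"
    if "u \<in> {v \<in> free_module n. mat_app m n M v = 0}"
      and "v \<in> {v \<in> free_module n. mat_app m n M v = 0}" for u v
    using that by (simp add: mat_app_add free_module_def)
qed (simp add: free_module_def mat_app_zero)

text \<open>The module-theoretic shadow of linear quotients. Ideals generated by variables have linear
  quotients themselves, which is why this property is inherited by syzygies.\<close>

definition linear_pieces :: "nat \<Rightarrow> (nat \<Rightarrow> ('v::finite, 'k::field) mpoly) set \<Rightarrow> bool" where
  "linear_pieces r N \<longleftrightarrow> submodule N \<and> N \<subseteq> free_module r \<and>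
     (\<exists>V. \<forall>k<r. (\<forall>v\<in>N. (\<forall>j>k. v j = 0) \<longrightarrow> v k \<in> ideal_span (var ` V k)) \<and>
        (\<forall>x\<in>V k. \<exists>g\<in>N. (\<forall>j. homogeneous 1 (g j)) \<and> g k = var x \<and> (\<forall>j>k. g j = 0)))"

text \<open>An analogue of a Groebner basis of \<open>N\<close>: the last nonzero coordinate of
  \<open>g l\<close> is the one at \<open>pos l\<close>, where it is the variable
  \<open>lead l\<close>. The generators are listed by increasing \<open>pos\<close>, so that last
  nonzero coordinates can be compared again for syzygies, whose coordinates are indexed by
  \<open>l\<close>.\<close>

locale leading_generators =
  fixes r :: nat and N :: "(nat \<Rightarrow> ('v::finite, 'k::field) mpoly) set"
    and n :: nat and pos :: "nat \<Rightarrow> nat" and lead :: "nat \<Rightarrow> 'v" and g :: "nat \<Rightarrow> nat \<Rightarrow> ('v, 'k) mpoly"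
  assumes submodule: "submodule N" and subset_free: "N \<subseteq> free_module r"
    and pos_mono: "l \<le> m \<Longrightarrow> m < n \<Longrightarrow> pos l \<le> pos m"
    and pos_lead_inj: "l < n \<Longrightarrow> m < n \<Longrightarrow> pos l = pos m \<Longrightarrow> lead l = lead m \<Longrightarrow> l = m"
    and gen_mem: "l < n \<Longrightarrow> g l \<in> N"
    and gen_homogeneous: "l < n \<Longrightarrow> homogeneous 1 (g l k)"
    and gen_lead: "l < n \<Longrightarrow> g l (pos l) = var (lead l)"
    and gen_above: "l < n \<Longrightarrow> pos l < k \<Longrightarrow> g l k = 0"
    and leading_coordinate: "v \<in> N \<Longrightarrow> (\<And>j. j > k \<Longrightarrow> v j = 0) \<Longrightarrow>
      v k \<in> ideal_span (var ` lead ` {l. l < n \<and> pos l = k})"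
begin

text \<open>Zero columns beyond \<open>n\<close> make the entries linear forms for all
  indices.\<close>

abbreviation M :: "nat \<Rightarrow> nat \<Rightarrow> ('v, 'k) mpoly" where
  "M \<equiv> \<lambda>k l. if l < n then g l k else 0"

lemma mat_app_eq: "mat_app r n M c = (\<lambda>k. \<Sum>l<n. g l k * c l)"
proof
  fix k
  have "g l k = 0" if "l < n" "\<not> k < r" for l
    using gen_mem[OF that(1)] subset_free that(2) by (auto simp: free_module_def)
  then show "mat_app r n M c k = (\<Sum>l<n. g l k * c l)"
    by (simp add: mat_app_def)
qed

lemma combination_mem: "(\<lambda>k. \<Sum>l<n. g l k * c l) \<in> N"
proof -
  have "(\<Sum>l\<in>{..<n}. (\<lambda>k. c l * g l k)) \<in> N"
    by (rule submodule_sum[OF submodule], rule submodule_scale[OF submodule])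
      (simp add: gen_mem)
  moreover have "(\<Sum>l\<in>{..<n}. (\<lambda>k. c l * g l k)) = (\<lambda>k. \<Sum>l<n. g l k * c l)"
    by (auto simp: fun_eq_iff sum_fun_eval algebra_simps)
  ultimately show ?thesis by simp
qed

text \<open>Division algorithm, by induction on \<open>K\<close>: the top coordinate is a
  combination of the leading variables at its position, and subtracting the same combination of
  generators kills it. For the syzygies it matters that only generators with
  \<open>pos l < K\<close> occur and that the coefficients have one degree less.\<close>

lemma generate:
  assumes "v \<in> N" "\<And>k. k \<ge> K \<Longrightarrow> v k = 0"
  shows "\<exists>c. (\<forall>l. l \<ge> n \<or> pos l \<ge> K \<longrightarrow> c l = 0) \<and> (\<forall>k. v k = (\<Sum>l<n. g l k * c l)) \<and>
     (\<forall>e. (\<forall>k. homogeneous (Suc e) (v k)) \<longrightarrow> (\<forall>l. homogeneous e (c l)))"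
  using assms
proof (induction K arbitrary: v)
  case 0
  then show ?case by (intro exI[of _ "\<lambda>_. 0"]) auto
next
  case (Suc K)
  let ?L = "{l. l < n \<and> pos l = K}"
  have finL: "finite ?L" by simp
  have inj: "inj_on lead ?L" using pos_lead_inj by (auto simp: inj_on_def)
  have "v K \<in> ideal_span (var ` lead ` ?L)"
    using Suc.prems by (intro leading_coordinate) auto
  then obtain a where a: "v K = (\<Sum>x\<in>lead ` ?L. a x * var x)"
    and a_keys: "\<And>x u. u \<in> keys (a x) \<Longrightarrow> u + Poly_Mapping.single x 1 \<in> keys (v K)"
    using ideal_span_var_coefficients[of "lead ` ?L" "v K"] finL by blast
  \<comment> \<open>The variables \<open>lead l\<close> with \<open>pos l = K\<close> are distinct,
    so each coefficient goes to a single generator.\<close>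
  define b where "b l = (if l \<in> ?L then a (lead l) else 0)" for l
  have bsum: "(\<Sum>l<n. g l k * b l) = (\<Sum>l\<in>?L. g l k * a (lead l))" for k
    unfolding b_def by (rule sum.mono_neutral_cong_right) auto
  define w where "w k = v k - (\<Sum>l<n. g l k * b l)" for k
  have "w \<in> N"
    using submodule_diff[OF submodule Suc.prems(1) combination_mem[of b]]
    by (simp add: w_def[abs_def] fun_diff_def)
  moreover have "w k = 0" if "k \<ge> K" for k
  proof (cases "k = K")
    case True
    have "(\<Sum>l\<in>?L. g l K * a (lead l)) = (\<Sum>l\<in>?L. a (lead l) * var (lead l))"
      by (intro sum.cong refl) (use gen_lead in auto)
    also have "\<dots> = v K" unfolding a by (rule sum.reindex_cong[OF inj refl, symmetric]) simp
    finally show ?thesis using True by (simp add: w_def bsum)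
  next
    case False
    then show ?thesis using that Suc.prems(2) gen_above by (simp add: w_def bsum)
  qed
  ultimately obtain c where c: "\<And>l. l \<ge> n \<or> pos l \<ge> K \<Longrightarrow> c l = 0"
    "\<And>k. w k = (\<Sum>l<n. g l k * c l)"
    "\<And>e l. (\<forall>k. homogeneous (Suc e) (w k)) \<Longrightarrow> homogeneous e (c l)"
    using Suc.IH[of w] by blast
  show ?case
  proof (intro exI[of _ "\<lambda>l. c l + b l"] conjI allI impI)
    fix l assume "n \<le> l \<or> Suc K \<le> pos l"
    then show "c l + b l = 0" using c(1) by (auto simp: b_def)
  next
    fix k
    have "v k = w k + (\<Sum>l<n. g l k * b l)" by (simp add: w_def)
    then show "v k = (\<Sum>l<n. g l k * (c l + b l))"
      by (simp add: c(2) sum.distrib algebra_simps)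
  next
    fix e l assume hv: "\<forall>k. homogeneous (Suc e) (v k)"
    have hb: "homogeneous e (b l)" for l
      using a_keys[of _ "lead l"] hv by (fastforce simp: b_def homogeneous_def mdegree_add)
    have "homogeneous (Suc e) (w k)" for k
      unfolding w_def
    proof (intro homogeneous_diff homogeneous_sum)
      fix l assume "l \<in> {..<n}"
      then show "homogeneous (Suc e) (g l k * b l)"
        using homogeneous_mult[OF gen_homogeneous hb] by simp
    qed (use hv in auto)
    then show "homogeneous e (c l + b l)" using c(3) hb by (simp add: homogeneous_add)
  qed
qed

lemma image_eq: "mat_app r n M ` free_module n = N"
proof
  show "mat_app r n M ` free_module n \<subseteq> N" using combination_mem by (auto simp: mat_app_eq)
  show "N \<subseteq> mat_app r n M ` free_module n"
  proof
    fix v assume "v \<in> N"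
    moreover then have "v k = 0" if "k \<ge> r" for k using subset_free that by (auto simp: free_module_def)
    ultimately obtain c where "\<forall>l\<ge>n. c l = 0" "\<forall>k. v k = (\<Sum>l<n. g l k * c l)"
      using generate[of v r] by blast
    then have "c \<in> free_module n" "v = mat_app r n M c" by (auto simp: free_module_def mat_app_eq)
    then show "v \<in> mat_app r n M ` free_module n" by blast
  qed
qed

text \<open>As in Schreyer's theorem, the leading coordinates of syzygies come from pairs of
  generators with the same leading position. At \<open>l\<close> they form the ideal generated by
  the leading variables of the earlier generators at position \<open>pos l\<close>.\<close>

lemma kernel_linear_pieces: "linear_pieces n {c \<in> free_module n. mat_app r n M c = 0}"
  (is "linear_pieces n ?Z")
proof -
  define V where "V l = lead ` {m. m < l \<and> pos m = pos l}" for l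
  have leading: "c l \<in> ideal_span (var ` V l)" if l: "l < n" and c: "c \<in> ?Z" "\<forall>j>l. c j = 0" for l c
  proof -
    let ?P = "{m. m < l \<and> pos m = pos l}"
    \<comment> \<open>Read the syzygy at coordinate \<open>pos l\<close>: the terms after
      \<open>l\<close> vanish by assumption, and earlier generators of smaller position are zero
      there.\<close>
    have "0 = (\<Sum>m<n. g m (pos l) * c m)" using c(1) by (auto simp: mat_app_eq fun_eq_iff)
    also have "\<dots> = (\<Sum>m\<in>insert l ?P. var (lead m) * c m)"
    proof (rule sum.mono_neutral_cong_right)
      show "\<forall>m\<in>{..<n} - insert l ?P. g m (pos l) * c m = 0"
      proof
        fix m assume m: "m \<in> {..<n} - insert l ?P"
        show "g m (pos l) * c m = 0"
        proof (cases "m > l")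
          case False
          then have "pos m < pos l" using m pos_mono[of m l] l by fastforce
          then show ?thesis using gen_above m by simp
        qed (use c in simp)
      qed
    next
      fix m assume "m \<in> insert l ?P"
      then have "m < n" "pos m = pos l" using l by auto
      then show "g m (pos l) * c m = var (lead m) * c m" using gen_lead[of m] by simp
    qed (use l in auto)
    also have "\<dots> = var (lead l) * c l + (\<Sum>m\<in>?P. var (lead m) * c m)" by simp
    finally have "c l * var (lead l) = - (\<Sum>m\<in>?P. c m * var (lead m))"
      by (simp add: eq_neg_iff_add_eq_0 mult.commute)
    also have "\<dots> \<in> ideal_span (var ` V l)"
      by (intro ideal_span_neg ideal_span_sum ideal_span_scale ideal_span_base) (auto simp: V_def)
    finally have "c l * var (lead l) \<in> ideal_span (var ` V l)" .
    moreover have "lead l \<notin> V l"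
    proof
      assume "lead l \<in> V l"
      then obtain m where "m < l" "pos m = pos l" "lead m = lead l" by (auto simp: V_def)
      then show False using pos_lead_inj[of m l] l by simp
    qed
    ultimately show ?thesis by (rule ideal_span_var_times_var)
  qed
  have lift: "\<exists>h\<in>?Z. (\<forall>j. homogeneous 1 (h j)) \<and> h l = var x \<and> (\<forall>j>l. h j = 0)"
    if l: "l < n" and x: "x \<in> V l" for l x
  proof -
    obtain m where m: "m < l" "pos m = pos l" "x = lead m" using x by (auto simp: V_def)
    then have mn: "m < n" using l by simp
    \<comment> \<open>The S-pair of \<open>g l\<close> and \<open>g m\<close>. Its leading terms
      cancel, so division uses only generators of position below \<open>pos l\<close>; the
      coefficients are linear because \<open>w\<close> is quadratic.\<close>
    define w where "w k = var x * g l k - var (lead l) * g m k" for k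
    have w_mem: "w \<in> N"
      using submodule_diff[OF submodule submodule_scale[OF submodule gen_mem[OF l]]
          submodule_scale[OF submodule gen_mem[OF mn]], of "var x" "var (lead l)"]
      by (simp add: w_def[abs_def] fun_diff_def)
    have w0: "w k = 0" if "k \<ge> pos l" for k
    proof (cases "k = pos l")
      case True
      then show ?thesis using gen_lead[OF l] gen_lead[OF mn] m by (simp add: w_def)
    next
      case False
      then show ?thesis using gen_above[OF l] gen_above[OF mn] m that by (simp add: w_def)
    qed
    have wh: "homogeneous (Suc 1) (w k)" for k
      unfolding w_def using homogeneous_mult[OF homogeneous_var(1) gen_homogeneous[OF l]]
        homogeneous_mult[OF homogeneous_var(1) gen_homogeneous[OF mn]]
      by (intro homogeneous_diff) (simp_all add: numeral_2_eq_2)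
    obtain c where c: "\<forall>j. j \<ge> n \<or> pos j \<ge> pos l \<longrightarrow> c j = 0"
      and cw: "\<forall>k. w k = (\<Sum>j<n. g j k * c j)"
      and c_hom: "\<forall>e. (\<forall>k. homogeneous (Suc e) (w k)) \<longrightarrow> (\<forall>j. homogeneous e (c j))"
      using generate[OF w_mem w0] by blast
    have ch: "homogeneous 1 (c j)" for j using c_hom wh by blast
    have c0: "c j = 0" if "j \<ge> n \<or> pos j \<ge> pos l" for j using c that by blast
    \<comment> \<open>The two multipliers of the S-pair minus the quotients \<open>c\<close> form a
      syzygy. As \<open>c j = 0\<close> whenever \<open>pos j \<ge> pos l\<close>, its entry at
      \<open>l\<close> remains \<open>var x\<close> and the later entries vanish.\<close>
    define h where "h j = (if j = l then var x else if j = m then - var (lead l) else 0) - c j" for j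
    have "(\<Sum>j<n. g j k * h j) = 0" for k
    proof -
      have "(\<Sum>j<n. g j k * h j)
          = (\<Sum>j<n. (if j = l then g l k * var x else 0) + (if j = m then - g m k * var (lead l) else 0)
              - g j k * c j)"
      proof (intro sum.cong refl)
        fix j
        show "g j k * h j = (if j = l then g l k * var x else 0)
            + (if j = m then - g m k * var (lead l) else 0) - g j k * c j"
          using m(1) by (cases "j = l"; cases "j = m") (simp_all add: h_def right_diff_distrib)
      qed
      also have "\<dots> = g l k * var x - g m k * var (lead l) - w k"
        using l mn by (simp add: sum_subtractf sum.distrib cw[rule_format])
      finally show ?thesis by (simp add: w_def)
    qed
    then have "mat_app r n M h = 0" by (simp add: mat_app_eq fun_eq_iff)
    moreover have "h j = 0" if "j \<ge> n" for j
      using c0[of j] that l mn by (simp add: h_def)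
    ultimately have "h \<in> ?Z" by (simp add: free_module_def)
    moreover have "homogeneous 1 (h j)" for j
      unfolding h_def by (rule homogeneous_diff[OF _ ch]) (simp add: homogeneous_uminus)
    moreover have "h l = var x" using c0[of l] by (simp add: h_def)
    moreover have "h j = 0" if "j > l" for j
    proof -
      have "c j = 0" using c0[of j] pos_mono[of l j] that by (cases "j < n") simp_all
      then show ?thesis using that m(1) by (simp add: h_def)
    qed
    ultimately show ?thesis by (intro bexI[of _ h]) simp_all
  qed
  show ?thesis
    unfolding linear_pieces_def
  proof (intro conjI exI[of _ V] allI impI ballI)
    show "submodule ?Z" by (rule submodule_kernel)
    show "?Z \<subseteq> free_module n" by blast
    show "c l \<in> ideal_span (var ` V l)" if "l < n" "c \<in> ?Z" "\<forall>j>l. c j = 0" for l c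
      using that by (rule leading)
    show "\<exists>h\<in>?Z. (\<forall>j. homogeneous 1 (h j)) \<and> h l = var x \<and> (\<forall>j>l. h j = 0)"
      if "l < n" "x \<in> V l" for l x
      using that by (rule lift)
  qed
qed

end

text \<open>One lifting is chosen for each position \<open>k\<close> and each variable in
  \<open>V k\<close>, and these pairs are sorted by position.\<close>

lemma linear_pieces_leading_generators:
  assumes "linear_pieces r N"
  obtains n pos lead g where "leading_generators r N n pos lead g"
proof -
  have sub: "submodule N" "N \<subseteq> free_module r"
    using assms by (simp_all only: linear_pieces_def)
  obtain V where V: "\<forall>k<r. (\<forall>v\<in>N. (\<forall>j>k. v j = 0) \<longrightarrow> v k \<in> ideal_span (var ` V k)) \<and>
      (\<forall>x\<in>V k. \<exists>g\<in>N. (\<forall>j. homogeneous 1 (g j)) \<and> g k = var x \<and> (\<forall>j>k. g j = 0))"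
    using assms unfolding linear_pieces_def by (elim conjE exE)
  define P where "P k x g \<longleftrightarrow>
    g \<in> N \<and> (\<forall>j. homogeneous 1 (g j)) \<and> g k = var x \<and> (\<forall>j>k. g j = 0)" for k x g
  define G where "G k x = (SOME g. P k x g)" for k x
  have G: "P k x (G k x)" if "k < r" "x \<in> V k" for k x
  proof -
    have "\<exists>g. P k x g"
      using V[rule_format, OF that(1)] that(2) unfolding P_def Bex_def by (elim conjE) (drule (1) bspec)
    then show ?thesis unfolding G_def by (rule someI_ex)
  qed
  define A where "A = Sigma {..<r} V"
  have "finite A" by (auto simp: A_def)
  then obtain xs where xs: "set xs = A" "distinct xs" using finite_distinct_list by blast
  define ys where "ys = sort_key fst xs"
  have ys: "set ys = A" "distinct ys" "sorted (map fst ys)" using xs by (auto simp: ys_def)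
  define pos lead where "pos l = fst (ys ! l)" and "lead l = snd (ys ! l)" for l
  have A: "pos l < r \<and> lead l \<in> V (pos l)" if "l < length ys" for l
  proof (cases "ys ! l")
    case (Pair k x)
    then have "(k, x) \<in> Sigma {..<r} V" using nth_mem[OF that] ys(1) by (simp add: A_def)
    then show ?thesis using Pair by (simp add: pos_def lead_def)
  qed
  have lead_image: "V k \<subseteq> lead ` {l. l < length ys \<and> pos l = k}" if "k < r" for k
  proof
    fix x assume "x \<in> V k"
    then have "(k, x) \<in> set ys" using that ys(1) by (simp add: A_def)
    then obtain l where "l < length ys" "ys ! l = (k, x)" by (metis in_set_conv_nth)
    then show "x \<in> lead ` {l. l < length ys \<and> pos l = k}"
      by (intro image_eqI[of _ _ l]) (simp_all add: pos_def lead_def)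
  qed
  have "leading_generators r N (length ys) pos lead (\<lambda>l. G (pos l) (lead l))"
  proof
    show "pos l \<le> pos m" if "l \<le> m" "m < length ys" for l m
      using sorted_nth_mono[OF ys(3), of l m] that by (simp add: pos_def)
    show "l = m" if "l < length ys" "m < length ys" "pos l = pos m" "lead l = lead m" for l m
      using that ys(2) nth_eq_iff_index_eq[OF ys(2)] by (auto simp: pos_def lead_def prod_eq_iff)
    show "v k \<in> ideal_span (var ` lead ` {l. l < length ys \<and> pos l = k})"
      if "v \<in> N" "\<And>j. j > k \<Longrightarrow> v j = 0" for v k
    proof (cases "k < r")
      case True
      then have "v k \<in> ideal_span (var ` V k)" using V that by blast
      then show ?thesis
        using module.span_mono[OF module_mult image_mono[OF lead_image[OF True]]] by blast
    next
      case False
      then have "v k = 0" using that(1) sub(2) by (auto simp: free_module_def)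
      then show ?thesis by (simp add: ideal_span_zero)
    qed
    fix l assume "l < length ys"
    then have l: "pos l < r" "lead l \<in> V (pos l)" using A by blast+
    show "G (pos l) (lead l) \<in> N"
      using G[OF l] unfolding P_def by (elim conjE)
    show "homogeneous 1 (G (pos l) (lead l) k)" for k
      using G[OF l] unfolding P_def by (elim conjE) (drule spec)
    show "G (pos l) (lead l) (pos l) = var (lead l)"
      using G[OF l] unfolding P_def by (elim conjE)
    show "G (pos l) (lead l) k = 0" if "pos l < k" for k
      using G[OF l] that unfolding P_def by (elim conjE) simp
  qed (rule sub)+
  then show ?thesis by (rule that)
qed

lemma linear_pieces_syzygies:
  assumes "linear_pieces r N"
  shows "\<exists>n M. (\<forall>k l. homogeneous 1 (M k l)) \<and> mat_app r n M ` free_module n = N \<and>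
    linear_pieces n {v \<in> free_module n. mat_app r n M v = 0}"
proof -
  obtain n pos lead g where g: "leading_generators r N n pos lead g"
    using linear_pieces_leading_generators[OF assms] .
  show ?thesis
    using leading_generators.image_eq[OF g] leading_generators.kernel_linear_pieces[OF g]
      leading_generators.gen_homogeneous[OF g]
    by (intro exI[of _ n] exI[of _ "\<lambda>k l. if l < n then g l k else 0"]) auto
qed


section \<open>Linear quotients and linear resolutions\<close>

text \<open>All basis elements in homological degree \<open>i\<close> have the same internal degree,
  so in any other degree the chains themselves are zero.\<close>

lemma tor_dim_eq_0:
  assumes deg: "\<And>k. gen_deg F i k = int d + int i" and "j \<noteq> int i + int d"
  shows "tor_dim F i j = 0"
proof -
  have "v = 0" if "v \<in> tor_chains F i j" for v
  proof
    fix k show "v k = 0 k"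
      using that assms by (cases "k < frank F i") (auto simp: tor_chains_def free_module_def)
  qed
  then have "tor_cycles F i j \<subseteq> {0}" by (cases i) auto
  then have "fun_dim (tor_cycles F i j) \<le> card ({} :: (nat \<Rightarrow> 'b) set)"
    by (intro vector_space.dim_le_card[OF vector_space_fun]) (simp_all add: module.span_empty[OF module_vec])
  then show ?thesis by (simp add: tor_dim_def)
qed

text \<open>The colon ideal of the earlier monomials by \<open>ms ! k\<close> is generated by
  variables: the equation says that \<open>x\<close> times \<open>ms ! k\<close> is a multiple of
  \<open>ms ! i\<close>, and the inequality that \<open>x\<close> divides the quotient of
  \<open>ms ! j\<close> by its gcd with \<open>ms ! k\<close>. Being strict, the inequality also
  excludes repetitions in the list.\<close>

definition linear_quotients :: "('v \<Rightarrow>\<^sub>0 nat) list \<Rightarrow> bool" where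
  "linear_quotients ms \<longleftrightarrow> (\<forall>k<length ms. \<forall>j<k. \<exists>i<k. \<exists>x y.
     ms ! i + Poly_Mapping.single y 1 = ms ! k + Poly_Mapping.single x 1 \<and>
     lookup (ms ! k) x < lookup (ms ! j) x)"

context
  fixes ms :: "('v::finite \<Rightarrow>\<^sub>0 nat) list"
  assumes lq: "linear_quotients ms"
begin

abbreviation (input) relations :: "(nat \<Rightarrow> ('v, 'k::field) mpoly) set" where
  "relations \<equiv> {v \<in> free_module (length ms). (\<Sum>l<length ms. monom (ms ! l) * v l) = 0}"

text \<open>If \<open>k\<close> is the last index of a relation, its entry there multiplies
  \<open>ms ! k\<close> into the ideal of the earlier monomials, hence lies in a colon ideal
  generated by variables. Each variable \<open>x\<close> in \<open>V k\<close> is attained by the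
  two-term relation with entries \<open>var x\<close> and \<open>- var y\<close>.\<close>

lemma linear_quotients_relations:
  "linear_pieces (length ms) (relations :: (nat \<Rightarrow> ('v, 'k::field) mpoly) set)"
proof -
  let ?n = "length ms"
  define V where "V k = {x. \<exists>i<k. \<exists>y.
    ms ! i + Poly_Mapping.single y 1 = ms ! k + Poly_Mapping.single x 1}" for k
  have "submodule (relations :: (nat \<Rightarrow> ('v, 'k) mpoly) set)"
  proof (rule submoduleI)
    show "(\<lambda>k. c * v k) \<in> relations" if "v \<in> relations" for c and v :: "nat \<Rightarrow> ('v, 'k) mpoly"
    proof -
      have "(\<Sum>l<?n. monom (ms ! l) * (c * v l)) = c * (\<Sum>l<?n. monom (ms ! l) * v l)"
        by (simp add: sum_distrib_left mult.left_commute)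
      then show ?thesis using that by (simp add: free_module_def)
    qed
  qed (auto simp: free_module_def distrib_left sum.distrib)
  moreover have "v k \<in> ideal_span (var ` V k)"
    if k: "k < ?n" and v: "v \<in> relations" "\<forall>j>k. v j = 0" for k and v :: "nat \<Rightarrow> ('v, 'k) mpoly"
  proof -
    have "0 = (\<Sum>l<?n. monom (ms ! l) * v l)" using v(1) by simp
    also have "\<dots> = (\<Sum>l\<in>insert k {..<k}. monom (ms ! l) * v l)"
      using k v(2) by (intro sum.mono_neutral_right) auto
    finally have "v k * monom (ms ! k) = - (\<Sum>l<k. v l * monom (ms ! l))"
      by (simp add: eq_neg_iff_add_eq_0 mult.commute)
    also have "\<dots> \<in> ideal_span (monom ` (!) ms ` {..<k})"
      by (intro ideal_span_neg ideal_span_sum ideal_span_scale ideal_span_base) auto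
    finally have *: "v k * monom (ms ! k) \<in> ideal_span (monom ` (!) ms ` {..<k})" .
    show ?thesis unfolding ideal_span_var
    proof
      fix u assume "u \<in> keys (v k)"
      then have "u + ms ! k \<in> keys (v k * monom (ms ! k))" by (simp add: keys_times_monom)
      then obtain j b where j: "j < k" "u + ms ! k = b + ms ! j"
        using * unfolding ideal_span_monom by blast
      then obtain i x y where i: "i < k" "ms ! i + Poly_Mapping.single y 1 = ms ! k + Poly_Mapping.single x 1"
        and x: "lookup (ms ! k) x < lookup (ms ! j) x"
        using lq k unfolding linear_quotients_def by blast
      have "lookup u x + lookup (ms ! k) x = lookup b x + lookup (ms ! j) x"
        using j(2) by (metis lookup_add)
      then have "lookup u x > 0" using x by simp
      moreover have "x \<in> V k" using i by (auto simp: V_def)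
      ultimately show "\<exists>x\<in>V k. 0 < lookup u x" by blast
    qed
  qed
  moreover have "\<exists>g\<in>relations. (\<forall>j. homogeneous 1 (g j)) \<and> g k = (var x :: ('v, 'k) mpoly) \<and> (\<forall>j>k. g j = 0)"
    if k: "k < ?n" and x: "x \<in> V k" for k x
  proof -
    obtain i y where i: "i < k" "ms ! i + Poly_Mapping.single y 1 = ms ! k + Poly_Mapping.single x 1"
      using x by (auto simp: V_def)
    define g :: "nat \<Rightarrow> ('v, 'k) mpoly" where
      "g j = (if j = k then var x else if j = i then - var y else 0)" for j
    have "(\<Sum>l<?n. monom (ms ! l) * g l)
      = (\<Sum>l<?n. (if l = k then monom (ms ! k) * var x else 0) + (if l = i then - (monom (ms ! i) * var y) else 0))"
    proof (intro sum.cong refl)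
      fix l
      show "monom (ms ! l) * g l
        = (if l = k then monom (ms ! k) * var x else 0) + (if l = i then - (monom (ms ! i) * var y) else 0)"
        using i(1) by (cases "l = k"; cases "l = i") (simp_all add: g_def)
    qed
    also have "\<dots> = monom (ms ! k) * var x - monom (ms ! i) * var y"
      using k i(1) by (simp add: sum.distrib)
    also have "\<dots> = 0" using i(2) by (simp add: var_eq_monom mult_single)
    finally have "g \<in> relations" using k i(1) by (simp add: free_module_def g_def)
    moreover have "homogeneous 1 (g j)" for j by (simp add: g_def homogeneous_uminus)
    moreover have "g k = var x" by (simp add: g_def)
    moreover have "g j = 0" if "j > k" for j using that i(1) by (simp add: g_def)
    ultimately show ?thesis by (intro bexI[of _ g]) simp_all
  qed
  ultimately show ?thesis
    unfolding linear_pieces_def by (intro conjI exI[of _ V] allI impI ballI) blast+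
qed

text \<open>Syzygies are iterated: a module with linear pieces is covered by a free module through
  linear forms, and the kernel has linear pieces again. Each differential raises the degree of the
  generators by one.\<close>

lemma linear_quotients_resolution:
  assumes deg: "\<And>m. m \<in> set ms \<Longrightarrow> mdegree m = d"
  obtains F :: "('v, 'k::field) mpoly free_complex" where
    "graded_free_resolution F (ideal_span (monom ` set ms))"
    "\<And>i k. gen_deg F i k = int d + int i"
proof -
  let ?n = "length ms"
  \<comment> \<open>A state consists of the rank of the current free module and the submodule to be
    covered next. The matrix \<open>M\<close> maps the next free module onto that submodule, and its
    kernel is the submodule in the next state.\<close>
  let ?R = "\<lambda>(S :: nat \<times> (nat \<Rightarrow> ('v, 'k) mpoly) set) T M.
      (\<forall>k l. homogeneous 1 (M k l)) \<and> mat_app (fst S) (fst T) M ` free_module (fst T) = snd S \<and>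
      snd T = {v \<in> free_module (fst T). mat_app (fst S) (fst T) M v = 0}"
  have "\<exists>f :: nat \<Rightarrow> nat \<times> (nat \<Rightarrow> ('v, 'k) mpoly) set. \<forall>i.
      (linear_pieces (fst (f i)) (snd (f i)) \<and> (i = 0 \<longrightarrow> f i = (?n, relations))) \<and>
      (\<exists>M. ?R (f i) (f (Suc i)) M)"
  proof (rule dependent_nat_choice)
    show "\<exists>S :: nat \<times> (nat \<Rightarrow> ('v, 'k) mpoly) set.
        linear_pieces (fst S) (snd S) \<and> ((0::nat) = 0 \<longrightarrow> S = (?n, relations))"
      using linear_quotients_relations by (intro exI[of _ "(?n, relations)"]) simp
  next
    fix S :: "nat \<times> (nat \<Rightarrow> ('v, 'k) mpoly) set" and i :: nat
    assume "linear_pieces (fst S) (snd S) \<and> (i = 0 \<longrightarrow> S = (?n, relations))"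
    then have "linear_pieces (fst S) (snd S)" ..
    from linear_pieces_syzygies[OF this] obtain n M where M: "\<forall>k l. homogeneous 1 (M k l)"
      "mat_app (fst S) n M ` free_module n = snd S"
      "linear_pieces n {v \<in> free_module n. mat_app (fst S) n M v = 0}"
      by (elim exE conjE)
    show "\<exists>T. (linear_pieces (fst T) (snd T) \<and> (Suc i = 0 \<longrightarrow> T = (?n, relations))) \<and>
        (\<exists>M. ?R S T M)"
      by (intro exI[of _ "(n, {v \<in> free_module n. mat_app (fst S) n M v = 0})"] conjI exI[of _ M])
        (simp_all only: fst_conv snd_conv M nat.distinct simp_thms)
  qed
  then obtain f :: "nat \<Rightarrow> nat \<times> (nat \<Rightarrow> ('v, 'k) mpoly) set"
    where f: "\<forall>i. (linear_pieces (fst (f i)) (snd (f i)) \<and> (i = 0 \<longrightarrow> f i = (?n, relations))) \<and>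
      (\<exists>M. ?R (f i) (f (Suc i)) M)" by (elim exE)
  have f0: "f 0 = (?n, relations)" using f[rule_format, of 0] by (elim conjE) simp
  have "\<forall>i. \<exists>M. ?R (f i) (f (Suc i)) M"
    by (rule allI) (rule f[rule_format, THEN conjunct2])
  then obtain M where "\<forall>i. ?R (f i) (f (Suc i)) (M i)" by (drule_tac choice) (elim exE)
  then have M_hom: "homogeneous 1 (M i k l)"
    and M_image: "mat_app (fst (f i)) (fst (f (Suc i))) (M i) ` free_module (fst (f (Suc i))) = snd (f i)"
    and M_kernel: "snd (f (Suc i)) = {v \<in> free_module (fst (f (Suc i))).
      mat_app (fst (f i)) (fst (f (Suc i))) (M i) v = 0}" for i k l
    by (simp_all only: simp_thms)
  define F where "F = \<lparr>frank = \<lambda>i. fst (f i), gen_deg = \<lambda>i k. int d + int i,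
      aug = \<lambda>l. monom (ms ! l), diff = M\<rparr>"
  have frank: "frank F i = fst (f i)" for i by (simp add: F_def)
  have diff: "diff_map F i = mat_app (fst (f i)) (fst (f (Suc i))) (M i)" for i
    by (simp add: diff_map_def F_def)
  have frank0: "frank F 0 = ?n" by (simp add: frank f0)
  have aug: "aug_map F = (\<lambda>v. \<Sum>l<?n. monom (ms ! l) * v l)"
    by (simp add: aug_map_def fun_eq_iff frank0) (simp add: F_def)
  have onto: "aug_map F ` free_module (frank F 0) = ideal_span (monom ` set ms)"
  proof
    show "aug_map F ` free_module (frank F 0) \<subseteq> ideal_span (monom ` set ms)"
    proof (rule image_subsetI)
      fix v :: "nat \<Rightarrow> ('v, 'k) mpoly"
      have "aug_map F v = (\<Sum>l<?n. v l * monom (ms ! l))" by (simp add: aug mult.commute)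
      also have "\<dots> \<in> ideal_span (monom ` set ms)"
        by (intro ideal_span_sum ideal_span_scale ideal_span_base) simp
      finally show "aug_map F v \<in> ideal_span (monom ` set ms)" .
    qed
    have "\<exists>v\<in>free_module ?n. p = (\<Sum>l<?n. monom (ms ! l) * v l)"
      if "p \<in> ideal_span (monom ` set ms)" for p :: "('v, 'k) mpoly"
      using that
    proof (induction rule: module.span_induct_alt[OF module_mult, consumes 1])
      case 1
      then show ?case by (intro bexI[of _ 0]) (simp_all add: free_module_def)
    next
      case (2 c x y)
      then obtain v m where v: "v \<in> free_module ?n" "y = (\<Sum>l<?n. monom (ms ! l) * v l)" and m: "m < ?n" "x = monom (ms ! m)"
        by (auto simp: in_set_conv_nth)
      have "c * x = (\<Sum>l<?n. if l = m then monom (ms ! m) * c else 0)"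
        using m by (simp add: mult.commute)
      also have "\<dots> = (\<Sum>l<?n. monom (ms ! l) * (if l = m then c else 0))"
        by (intro sum.cong) auto
      finally have "c * x + y = (\<Sum>l<?n. monom (ms ! l) * ((if l = m then c else 0) + v l))"
        by (simp add: v distrib_left sum.distrib)
      moreover have "(\<lambda>l. (if l = m then c else 0) + v l) \<in> free_module ?n"
        using v(1) m(1) by (auto simp: free_module_def)
      ultimately show ?case
        by (rule bexI[where x = "\<lambda>l. (if l = m then c else 0) + v l"])
    qed
    then show "ideal_span (monom ` set ms) \<subseteq> aug_map F ` free_module (frank F 0)"
      by (auto simp: aug frank0)
  qed
  have exact0: "{v \<in> free_module (frank F 0). aug_map F v = 0} = diff_map F 0 ` free_module (frank F 1)"
    using M_image[of 0] by (simp add: aug frank0 diff frank f0)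
  have exact: "{v \<in> free_module (frank F (Suc i)). diff_map F i v = 0}
      = diff_map F (Suc i) ` free_module (frank F (Suc (Suc i)))" for i
    using M_kernel[of i] M_image[of "Suc i"] by (simp add: diff frank)
  have aug_deg: "int (mdegree m) = gen_deg F 0 l" if "l < frank F 0" "m \<in> keys (aug F l)" for l m
    using that deg[of "ms ! l"] by (simp add: F_def f0)
  have diff_deg: "gen_deg F i k + int (mdegree m) = gen_deg F (Suc i) l" if "m \<in> keys (diff F i k l)" for i k l m
    using that M_hom[of i k l] by (simp add: F_def homogeneous_def)
  have "graded_free_resolution F (ideal_span (monom ` set ms))"
    unfolding graded_free_resolution_def
    by (intro conjI allI impI ballI onto exact0 exact aug_deg diff_deg)
  moreover have "gen_deg F i k = int d + int i" for i k by (simp add: F_def)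
  ultimately show ?thesis by (rule that)
qed

end

text \<open>As \<open>betti\<close> is a least value, exhibiting one resolution with vanishing
  \<open>tor_dim\<close> determines it.\<close>

lemma linear_quotients_betti:
  assumes "linear_quotients ms" "\<And>m. m \<in> set ms \<Longrightarrow> mdegree m = d" "j \<noteq> int i + int d"
  shows "betti (ideal_span (monom ` set ms) :: ('v::finite, 'k::field) mpoly set) i j = 0"
proof -
  obtain F :: "('v, 'k) mpoly free_complex" where
    "graded_free_resolution F (ideal_span (monom ` set ms))" "\<And>i k. gen_deg F i k = int d + int i"
    using linear_quotients_resolution[OF assms(1,2)] by blast
  then have "\<exists>F. graded_free_resolution F (ideal_span (monom ` set ms) :: ('v, 'k) mpoly set) \<and> 0 = tor_dim F i j"
    using tor_dim_eq_0[OF _ assms(3)] by metis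
  then show ?thesis unfolding betti_def by (rule Least_eq_0)
qed

section \<open>Degree components of monomial ideals\<close>

lemma degree_ideal_homogeneous: "homogeneous_ideal (degree_ideal L d)"
proof -
  let ?D = "degree_ideal L d"
  have "is_ideal ?D" unfolding degree_ideal_def by (rule module.subspace_span[OF module_mult])
  moreover have "degree_part L d \<subseteq> (\<Union>e. degree_part ?D e)"
    by (auto simp: degree_part_def degree_ideal_def intro: ideal_span_base)
  then have "?D \<subseteq> ideal_span (\<Union>e. degree_part ?D e)"
    by (subst degree_ideal_def) (rule module.span_mono[OF module_mult])
  moreover have "ideal_span (\<Union>e. degree_part ?D e) \<subseteq> ?D"
    by (rule ideal_span_minimal) (use \<open>is_ideal ?D\<close> in \<open>auto simp: degree_part_def\<close>)
  ultimately show ?thesis unfolding homogeneous_ideal_def by blast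
qed

lemma degree_ideal_monomial:
  assumes L: "\<And>p :: ('v::finite, 'k::field) mpoly. p \<in> L \<longleftrightarrow> (\<forall>m\<in>keys p. m \<in> A)"
  shows "degree_ideal L d = ideal_span (monom ` {m \<in> A. mdegree m = d})"
proof
  show "degree_ideal L d \<subseteq> ideal_span (monom ` {m \<in> A. mdegree m = d})"
    unfolding degree_ideal_def
  proof (rule ideal_span_minimal[OF _ module.subspace_span[OF module_mult]])
    show "degree_part L d \<subseteq> ideal_span (monom ` {m \<in> A. mdegree m = d})"
    proof
      fix p assume p: "p \<in> degree_part L d"
      have "\<exists>a\<in>{m \<in> A. mdegree m = d}. \<exists>b. u = b + a" if "u \<in> keys p" for u
        using p that by (intro bexI[of _ u] exI[of _ 0]) (auto simp: degree_part_def homogeneous_def L)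
      then show "p \<in> ideal_span (monom ` {m \<in> A. mdegree m = d})" unfolding ideal_span_monom by blast
    qed
  qed
  show "ideal_span (monom ` {m \<in> A. mdegree m = d}) \<subseteq> degree_ideal L d"
    unfolding degree_ideal_def
    by (rule module.span_mono[OF module_mult]) (auto simp: degree_part_def homogeneous_def L)
qed

lemma linear_quotients_has_linear_resolution:
  assumes L: "\<And>p :: ('v::finite, 'k::field) mpoly. p \<in> L \<longleftrightarrow> (\<forall>m\<in>keys p. m \<in> A)"
    and "linear_quotients ms" and ms: "set ms = {m \<in> A. mdegree m = d}" and "ms \<noteq> []"
  shows "has_linear_resolution (degree_ideal L d) d"
proof -
  have eq: "degree_ideal L d = ideal_span (monom ` set ms)"
    unfolding ms using L by (rule degree_ideal_monomial)
  obtain m where "m \<in> set ms" using \<open>ms \<noteq> []\<close> by (cases ms) auto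
  then have "(monom m :: ('v, 'k) mpoly) \<in> degree_ideal L d" unfolding eq by (auto intro: ideal_span_base)
  moreover have "(monom m :: ('v, 'k) mpoly) \<noteq> 0" by (metis lookup_single_eq lookup_zero zero_neq_one)
  ultimately have "degree_ideal L d \<noteq> {0}" by blast
  moreover have "betti (degree_ideal L d) i j = 0" if "j \<noteq> int i + int d" for i j
    unfolding eq using linear_quotients_betti[OF assms(2) _ that] ms by blast
  ultimately show ?thesis
    unfolding has_linear_resolution_def using degree_ideal_homogeneous by blast
qed


section \<open>Linear quotients of truncations\<close>

lemma exists_minus_single:
  fixes w :: "'v \<Rightarrow>\<^sub>0 nat"
  assumes "lookup w x > 0"
  obtains u where "w = u + Poly_Mapping.single x 1"
proof
  show "w = (w - Poly_Mapping.single x 1) + Poly_Mapping.single x 1"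
    using assms by (intro poly_mapping_eqI) (auto simp: lookup_add_single lookup_minus lookup_single when_def)
qed

lemma keys_add_single:
  fixes u :: "'v \<Rightarrow>\<^sub>0 nat"
  shows "c > 0 \<Longrightarrow> keys (u + Poly_Mapping.single x c) = insert x (keys u)"
  by (auto simp: in_keys_iff lookup_add_single split: if_splits)

lemma mdegree_eq_0: "mdegree m = 0 \<longleftrightarrow> m = 0"
  by (auto simp: mdegree_def poly_mapping_eq_iff fun_eq_iff)

text \<open>The order of a monomial along the prime ideal generated by the variables in
  \<open>S\<close>: it is at least \<open>s\<close> exactly when the monomial lies in the
  \<open>s\<close>-th power of that prime.\<close>

definition weight :: "('v::finite \<Rightarrow>\<^sub>0 nat) \<Rightarrow> 'v set \<Rightarrow> nat" where
  "weight m S = (\<Sum>v\<in>S. lookup m v)"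

lemma weight_add: "weight (a + b) S = weight a S + weight b S"
  by (simp add: weight_def lookup_add sum.distrib)

lemma weight_add_single:
  "weight (m + Poly_Mapping.single x c) S = weight m S + (if x \<in> S then c else 0)"
  by (simp add: weight_def lookup_add_single sum.distrib)

lemma weight_mono: "S \<subseteq> T \<Longrightarrow> weight m S \<le> weight m T"
  by (simp add: weight_def sum_mono2)

lemma weight_le_mdegree: "weight m S \<le> mdegree m"
  unfolding mdegree_def weight_def by (rule sum_mono2) auto

lemma weight_Compl: "weight m S + weight m (- S) = mdegree m"
  unfolding weight_def mdegree_def
  by (subst sum.union_disjoint[symmetric]) (auto intro!: sum.cong)

lemma weight_Int_keys: "keys m \<subseteq> U \<Longrightarrow> weight m (S \<inter> U) = weight m S"
  unfolding weight_def by (rule sum.mono_neutral_left) (auto simp: in_keys_iff)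

lemma linear_quotients_Nil: "linear_quotients []"
  by (simp add: linear_quotients_def)

lemma linear_quotients_singleton: "linear_quotients [m]"
  by (simp add: linear_quotients_def)

text \<open>Inside either block the exchange is inherited. Between an earlier monomial of the first
  block and a \<open>v\<close> of the second, the exchange variable is \<open>x\<close>: if
  \<open>v\<close> is \<open>u\<close> times \<open>y\<close>, then \<open>x\<close> times
  \<open>v\<close> is \<open>y\<close> times the earlier monomial
  \<open>u + Poly_Mapping.single x 1\<close>, and \<open>x\<close> divides the whole first block but
  not \<open>v\<close>.\<close>

lemma linear_quotients_append:
  assumes us: "linear_quotients us" and vs: "linear_quotients vs"
    and x: "\<And>v. v \<in> set vs \<Longrightarrow> lookup v x = 0"
    and exchange: "\<And>v. v \<in> set vs \<Longrightarrow> us \<noteq> [] \<Longrightarrow> \<exists>u\<in>set us. \<exists>y. v = u + Poly_Mapping.single y 1"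
  shows "linear_quotients (map (\<lambda>u. u + Poly_Mapping.single x 1) us @ vs)"
    (is "linear_quotients ?ms")
  unfolding linear_quotients_def
proof (intro allI impI)
  let ?e = "\<lambda>x. Poly_Mapping.single x (1::nat)"
  fix k j assume kj: "k < length ?ms" "j < k"
  let ?n = "length us"
  show "\<exists>i<k. \<exists>x y. ?ms ! i + ?e y = ?ms ! k + ?e x \<and> lookup (?ms ! k) x < lookup (?ms ! j) x"
  proof (cases "k < ?n")
    case True
    then obtain i z y where i: "i < k" "us ! i + ?e y = us ! k + ?e z" "lookup (us ! k) z < lookup (us ! j) z"
      using us kj(2) unfolding linear_quotients_def by blast
    have "?ms ! i + ?e y = (us ! i + ?e y) + ?e x"
      using i(1) True by (simp add: nth_append add_ac)
    also have "\<dots> = ?ms ! k + ?e z"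
      using True by (simp only: i(2)) (simp add: nth_append add_ac)
    finally have "?ms ! i + ?e y = ?ms ! k + ?e z" .
    moreover have "lookup (?ms ! k) z < lookup (?ms ! j) z"
      using i(3) True kj(2) by (simp add: nth_append lookup_add)
    ultimately show ?thesis using i(1) by blast
  next
    case False
    define v where "v = vs ! (k - ?n)"
    have v: "v \<in> set vs" "?ms ! k = v" using False kj(1) by (auto simp: v_def nth_append)
    show ?thesis
    proof (cases "j < ?n")
      case True
      then have "us \<noteq> []" by auto
      then obtain i y where i: "i < ?n" "v = us ! i + ?e y"
        using exchange[OF v(1)] by (auto simp: in_set_conv_nth)
      have "?ms ! i + ?e y = ?ms ! k + ?e x" using i by (simp only: v(2)) (simp add: nth_append add_ac)
      moreover have "lookup (?ms ! k) x < lookup (?ms ! j) x"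
        using True x[OF v(1)] v(2) by (simp add: nth_append lookup_add)
      ultimately show ?thesis using i(1) False by (meson less_le_trans not_less)
    next
      case j: False
      have "k - ?n < length vs" "j - ?n < k - ?n" using False kj j by auto
      then obtain i z y where i: "i < k - ?n" "vs ! i + ?e y = vs ! (k - ?n) + ?e z"
        "lookup (vs ! (k - ?n)) z < lookup (vs ! (j - ?n)) z"
        using vs unfolding linear_quotients_def by blast
      then have "?ms ! (i + ?n) + ?e y = ?ms ! k + ?e z \<and> lookup (?ms ! k) z < lookup (?ms ! j) z"
        using False j by (simp add: nth_append)
      moreover have "i + ?n < k" using i(1) by simp
      ultimately show ?thesis by blast
    qed
  qed
qed

text \<open>For the ideal spanned by the monomials in \<open>L\<close>: its part of degree at least \<open>d\<close> is generated
  in degree \<open>d\<close> and has linear quotients.\<close>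

definition truncation_linear :: "('v::finite \<Rightarrow>\<^sub>0 nat) set \<Rightarrow> nat \<Rightarrow> bool" where
  "truncation_linear L d \<longleftrightarrow>
     (\<forall>w\<in>L. mdegree w = Suc d \<longrightarrow> (\<exists>u\<in>L. \<exists>y. w = u + Poly_Mapping.single y 1)) \<and>
     (\<exists>ms. linear_quotients ms \<and> set ms = {m \<in> L. mdegree m = d})"

text \<open>A monomial of \<open>L\<close> of degree \<open>Suc d\<close> without \<open>x\<close>
  lies in the colon ideal by \<open>up\<close>. Its degree there exceeds \<open>d\<close>, so it is
  a variable times an element of the colon ideal of degree \<open>d\<close>; this is the exchange
  needed for appending, and the reason why \<open>truncation_linear\<close> includes
  generation.\<close>

lemma truncation_linear_split:
  fixes L :: "('v::finite \<Rightarrow>\<^sub>0 nat) set"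
  assumes colon: "truncation_linear {w. w + Poly_Mapping.single x 1 \<in> L} d"
    and restriction: "truncation_linear {w \<in> L. lookup w x = 0} (Suc d)"
    and up: "\<And>w. w \<in> L \<Longrightarrow> w + Poly_Mapping.single x 1 \<in> L"
  shows "truncation_linear L (Suc d)"
proof -
  let ?e = "\<lambda>x. Poly_Mapping.single x (1::nat)"
  have gen_colon: "\<exists>u y. u + ?e x \<in> L \<and> w = u + ?e y" if "w + ?e x \<in> L" "mdegree w = Suc d" for w
    using colon that unfolding truncation_linear_def by blast
  obtain us where us: "linear_quotients us" "set us = {m. m + ?e x \<in> L \<and> mdegree m = d}"
    using colon unfolding truncation_linear_def by auto
  obtain vs where vs: "linear_quotients vs" "set vs = {m. m \<in> L \<and> lookup m x = 0 \<and> mdegree m = Suc d}"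
    using restriction unfolding truncation_linear_def by auto
  have "\<exists>u\<in>L. \<exists>y. w = u + ?e y" if w: "w \<in> L" "mdegree w = Suc (Suc d)" for w
  proof (cases "lookup w x = 0")
    case True
    then show ?thesis using restriction w unfolding truncation_linear_def by blast
  next
    case False
    then obtain v where v: "w = v + ?e x" using exists_minus_single[of w x] by blast
    then obtain u y where "u + ?e x \<in> L" "v = u + ?e y"
      using gen_colon[of v] w by (auto simp: mdegree_add)
    then show ?thesis using v by (intro bexI[of _ "u + ?e x"] exI[of _ y]) (simp_all add: add_ac)
  qed
  moreover have "linear_quotients (map (\<lambda>u. u + ?e x) us @ vs)"
  proof (rule linear_quotients_append[OF us(1) vs(1)])
    fix v assume "v \<in> set vs"
    then show "\<exists>u\<in>set us. \<exists>y. v = u + ?e y"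
      using gen_colon[of v] up[of v] by (fastforce simp: us(2) vs(2) mdegree_add)
  qed (simp add: vs(2))
  moreover have "set (map (\<lambda>u. u + ?e x) us @ vs) = {m \<in> L. mdegree m = Suc d}"
  proof -
    have "m \<in> (\<lambda>u. u + ?e x) ` set us" if m: "m \<in> L" "mdegree m = Suc d" "lookup m x \<noteq> 0" for m
    proof -
      obtain u where "m = u + ?e x" using exists_minus_single[of m x] m(3) by blast
      then show ?thesis using m by (auto simp: us(2) mdegree_add)
    qed
    then show ?thesis by (auto simp: us(2) vs(2) mdegree_add)
  qed
  ultimately show ?thesis unfolding truncation_linear_def by blast
qed

lemma truncation_linear_empty: "truncation_linear {} d"
  unfolding truncation_linear_def by (auto intro!: exI[of _ "[]"] linear_quotients_Nil)

text \<open>Split on variables until no constraint is left. The truncated difference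
  \<open>f z - f (p z)\<close> is the increase of the bound along the edge from \<open>p z\<close>
  to \<open>z\<close>. Dividing by a suitable variable lowers the sum of these increases, while
  setting a variable aside lowers \<open>card U\<close>.\<close>

lemma truncation_linear_forest:
  fixes f rank :: "'b::finite \<Rightarrow> nat" and p :: "'b \<Rightarrow> 'b" and Y :: "'b \<Rightarrow> 'v::finite set"
  assumes "\<And>z. f (p z) > 0 \<Longrightarrow> Y (p z) \<subseteq> Y z \<and> rank z < rank (p z)"
    and "(\<Sum>z\<in>UNIV. f z - f (p z)) \<le> d"
  shows "truncation_linear {w. keys w \<subseteq> U \<and> (\<forall>z. f z \<le> weight w (Y z))} d"
  using assms
proof (induction "d + card U" arbitrary: d U f rule: less_induct)
  case less
  let ?e = "\<lambda>x. Poly_Mapping.single x (1::nat)"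
  let ?L = "\<lambda>f U. {w. keys w \<subseteq> U \<and> (\<forall>z. f z \<le> weight w (Y z))}"
  have step: ?case
    if x: "x \<in> U" and d: "d = Suc d'"
      and drop: "(\<Sum>z\<in>UNIV. (f z - of_bool (x \<in> Y z)) - (f (p z) - of_bool (x \<in> Y (p z)))) \<le> d'" for x d'
    unfolding d
  proof (rule truncation_linear_split[where x = x])
    \<comment> \<open>Dividing by \<open>x\<close> relaxes by one, but not below zero, exactly those
      bounds whose set \<open>Y z\<close> contains \<open>x\<close>.\<close>
    have "{w. w + ?e x \<in> ?L f U} = ?L (\<lambda>z. f z - of_bool (x \<in> Y z)) U"
      using x by (auto simp: keys_add_single weight_add_single le_diff_conv of_bool_def)
    moreover have "truncation_linear (?L (\<lambda>z. f z - of_bool (x \<in> Y z)) U) d'"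
    proof (rule less.hyps)
      show "Y (p z) \<subseteq> Y z \<and> rank z < rank (p z)" if "0 < f (p z) - of_bool (x \<in> Y (p z))" for z
        using less.prems(1)[of z] less_le_trans[OF that diff_le_self] by blast
      show "d' + card U < d + card U" by (simp add: d)
    qed (rule drop)
    ultimately show "truncation_linear {w. w + ?e x \<in> ?L f U} d'" by simp
    have "{w \<in> ?L f U. lookup w x = 0} = ?L f (U - {x})"
      by (auto simp: in_keys_iff)
    moreover have "truncation_linear (?L f (U - {x})) (Suc d')"
      using less.prems x card_Diff1_less[of U x] by (intro less.hyps) (auto simp: d)
    ultimately show "truncation_linear {w \<in> ?L f U. lookup w x = 0} (Suc d')" by simp
    show "w + ?e x \<in> ?L f U" if "w \<in> ?L f U" for w
      using that x by (auto simp: keys_add_single weight_add_single intro: le_SucI)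
  qed
  show ?case
  proof (cases "\<forall>z. f z = 0")
    \<comment> \<open>Without constraints any variable of \<open>U\<close> can be split off, until
      the degree is zero or \<open>U\<close> is empty.\<close>
    case True
    show ?thesis
    proof (cases d)
      case 0
      have "\<exists>u. keys u \<subseteq> U \<and> (\<exists>y. w = u + ?e y)" if w: "keys w \<subseteq> U" "mdegree w = Suc 0" for w
      proof -
        have "\<exists>x. lookup w x \<noteq> 0"
        proof (rule ccontr)
          assume "\<nexists>x. lookup w x \<noteq> 0"
          then show False using w(2) by (simp add: mdegree_def)
        qed
        then obtain x where "lookup w x > 0" by blast
        then obtain u where "w = u + ?e x" using exists_minus_single[of w x] by blast
        then show ?thesis using w(1) by (auto simp: keys_add_single)
      qed
      moreover have "{m. keys m \<subseteq> U \<and> mdegree m = 0} = set [0]" by (auto simp: mdegree_eq_0)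
      ultimately show ?thesis
        using True 0 linear_quotients_singleton[of 0] unfolding truncation_linear_def by auto
    next
      case (Suc d')
      show ?thesis
      proof (cases "U = {}")
        case True
        then have "m = 0" if "keys m \<subseteq> U" for m :: "'v \<Rightarrow>\<^sub>0 nat" using that by simp
        then have "mdegree m \<noteq> Suc e" if "keys m \<subseteq> U" for m :: "'v \<Rightarrow>\<^sub>0 nat" and e
          using that mdegree_eq_0[of m] by auto
        then show ?thesis
          unfolding truncation_linear_def Suc by (auto intro!: exI[of _ "[]"] linear_quotients_Nil)
      next
        case False
        then obtain x where "x \<in> U" by blast
        then show ?thesis using step[OF _ Suc] \<open>\<forall>z. f z = 0\<close> by simp
      qed
    qed
  next
    case False
    text \<open>A constraint closest to the root among the nontrivial ones: a variable relaxing it lowers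
      the bound.\<close>
    let ?S = "{z. f z > 0}"
    have "Max (rank ` ?S) \<in> rank ` ?S" using False by (intro Max_in) auto
    then obtain c where c: "f c > 0" "rank c = Max (rank ` ?S)" by auto
    have cmax: "rank z \<le> rank c" if "f z > 0" for z
      unfolding c(2) using that by (intro Max_ge) auto
    \<comment> \<open>A positive bound at the parent would have larger rank than \<open>c\<close>.
      So the edge at \<open>c\<close> contributes all of \<open>f c\<close>, and this drops when
      \<open>f c\<close> does.\<close>
    have pc: "f (p c) = 0" using less.prems(1)[of c] cmax[of "p c"] by (cases "f (p c)") auto
    show ?thesis
    proof (cases "Y c \<inter> U = {}")
      case True
      \<comment> \<open>A positive bound on variables no longer available cannot be met.\<close>
      have "weight w (Y c) = 0" if "keys w \<subseteq> U" for w
        using weight_Int_keys[OF that, of "Y c"] True by (simp add: weight_def)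
      then have "w \<notin> ?L f U" for w using c(1) by (auto intro!: exI[of _ c])
      then have "?L f U = {}" by blast
      then show ?thesis by (simp only: truncation_linear_empty)
    next
      case False
      then obtain x where x: "x \<in> Y c" "x \<in> U" by blast
      let ?g = "\<lambda>z. (f z - of_bool (x \<in> Y z)) - (f (p z) - of_bool (x \<in> Y (p z)))"
      have "(\<Sum>z\<in>UNIV. ?g z) < (\<Sum>z\<in>UNIV. f z - f (p z))"
      proof (rule sum_strict_mono_ex1)
        \<comment> \<open>If \<open>f (p z) = 0\<close>, only the first term can drop. Otherwise
          \<open>Y (p z) \<subseteq> Y z\<close>, so when the bound at the parent drops, the bound
          at \<open>z\<close> drops too unless it is zero already.\<close>
        show "\<forall>z\<in>UNIV. ?g z \<le> f z - f (p z)"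
        proof
          fix z show "?g z \<le> f z - f (p z)"
            using less.prems(1)[of z] by (cases "f (p z)") (auto simp: of_bool_def)
        qed
        show "\<exists>z\<in>UNIV. ?g z < f z - f (p z)"
          using c pc x(1) by (intro bexI[of _ c]) auto
      qed simp
      then show ?thesis using less.prems(2) step[OF x(2), of "d - 1"] by fastforce
    qed
  qed
qed


section \<open>Elimination along a perfect elimination order\<close>

locale perfect_elimination =
  fixes adj :: "'v::finite \<Rightarrow> 'v \<Rightarrow> bool" and idx :: "'v \<Rightarrow> nat"
  assumes sym: "adj u v \<Longrightarrow> adj v u"
    and irrefl: "\<not> adj v v"
    and inj: "inj idx"
    and later_clique: "adj u v \<Longrightarrow> adj u w \<Longrightarrow> idx u < idx v \<Longrightarrow> idx u < idx w \<Longrightarrow> v \<noteq> w \<Longrightarrow> adj v w"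
begin

definition later :: "'v \<Rightarrow> 'v set" where
  "later z = {w. adj z w \<and> idx z < idx w}"

definition bag :: "'v \<Rightarrow> 'v set" where
  "bag z = insert z (later z)"

text \<open>The tree of bags: the parent of a vertex is its first later neighbour. The additional
  root \<open>None\<close> will carry the trivial constraint.\<close>

definition parent :: "'v option \<Rightarrow> 'v option" where
  "parent z = (case z of None \<Rightarrow> None
     | Some v \<Rightarrow> if later v = {} then None else Some (arg_min_on idx (later v)))"

text \<open>The other later neighbours of \<open>v\<close> come after the first one,
  \<open>q\<close>, and are adjacent to it because later neighbours form a clique.\<close>

lemma parent_cases:
  obtains "later v = {}" "parent (Some v) = None"
  | q where "parent (Some v) = Some q" "q \<in> later v" "later v \<subseteq> bag q"
proof (cases "later v = {}")
  case True
  then show ?thesis using that by (simp add: parent_def)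
next
  case False
  define q where "q = arg_min_on idx (later v)"
  have q: "q \<in> later v" using False by (simp add: q_def arg_min_if_finite)
  have "w \<in> bag q" if w: "w \<in> later v" for w
  proof (cases "w = q")
    case True
    then show ?thesis by (simp add: bag_def)
  next
    case False
    have "\<not> idx w < idx q" using w arg_min_if_finite(2)[of "later v" idx] unfolding q_def by auto
    then have "idx q < idx w" using False inj by (metis injD linorder_neqE_nat)
    moreover have "adj q w" using q w False later_clique by (auto simp: later_def)
    ultimately show ?thesis by (simp add: bag_def later_def)
  qed
  moreover have "parent (Some v) = Some q" using False by (simp add: parent_def q_def)
  ultimately show ?thesis using that q by blast
qed

lemma exists_minimum:
  assumes "U \<noteq> {}"
  obtains x where "x \<in> U" "\<forall>u\<in>U. idx x \<le> idx u"
proof (rule that)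
  show "arg_min_on idx U \<in> U" using assms by (intro arg_min_if_finite(1)) simp_all
  show "\<forall>u\<in>U. idx (arg_min_on idx U) \<le> idx u"
    using arg_min_if_finite(2)[of U idx] assms by (auto simp: not_less)
qed

text \<open>When \<open>s\<close> units have been placed on the already eliminated vertices, the remaining constraints
  form the forest of bags, in which \<open>U - bag z\<close> decreases towards the roots.\<close>

lemma truncation_linear_placed:
  assumes upward: "\<And>u v. u \<in> U \<Longrightarrow> idx u \<le> idx v \<Longrightarrow> v \<in> U"
    and below: "\<And>a u. a \<in> keys \<alpha> \<Longrightarrow> u \<in> U \<Longrightarrow> idx a \<le> idx u"
    and s: "mdegree \<alpha> = s" and d: "s \<le> d"
  shows "truncation_linear {w. keys w \<subseteq> U \<and> (\<forall>z. s \<le> weight (w + \<alpha>) (- bag z))} d"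
proof -
  \<comment> \<open>As \<alpha> has degree \<open>s\<close>, its weight on \<open>bag v\<close> is
    what it lacks outside of \<open>bag v\<close>, and \<open>w\<close> has to supply this
    amount.\<close>
  define f where "f z = (case z of None \<Rightarrow> 0 | Some v \<Rightarrow> weight \<alpha> (bag v))" for z
  define Y where "Y z = (case z of None \<Rightarrow> {} | Some v \<Rightarrow> - bag v \<inter> U)" for z
  define rank where "rank z = (case z of None \<Rightarrow> 0 | Some v \<Rightarrow> idx v)" for z
  have "truncation_linear {w. keys w \<subseteq> U \<and> (\<forall>z. f z \<le> weight w (Y z))} d"
  proof (rule truncation_linear_forest[where p = parent and rank = rank])
    fix z assume pos: "f (parent z) > 0"
    show "Y (parent z) \<subseteq> Y z \<and> rank z < rank (parent z)"
    proof (cases z)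
      case None
      then show ?thesis using pos by (simp add: f_def parent_def)
    next
      case (Some v)
      show ?thesis
      proof (rule parent_cases[of v])
        assume "parent (Some v) = None"
        then show ?thesis using pos Some by (simp add: f_def)
      next
        fix q assume q: "parent (Some v) = Some q" "q \<in> later v" "later v \<subseteq> bag q"
        have "weight \<alpha> (bag q) > 0" using pos q(1) Some by (simp add: f_def)
        \<comment> \<open>A positive bound at \<open>q\<close> means that a unit was placed in
          \<open>bag q\<close>, hence after \<open>v\<close>. No vertex of \<open>U\<close> precedes
          a placed one, so \<open>v\<close> is not in \<open>U\<close>; and \<open>v\<close> is the
          only vertex of \<open>bag v\<close> that \<open>bag q\<close> may miss.\<close>
        then obtain a where a: "a \<in> bag q" "a \<in> keys \<alpha>"
          unfolding weight_def by (metis in_keys_iff less_irrefl sum.neutral)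
        have vq: "idx v < idx q" using q(2) by (simp add: later_def)
        moreover have "idx q \<le> idx a" using a(1) by (auto simp: bag_def later_def)
        ultimately have "v \<notin> U" using below[OF a(2)] by fastforce
        then have "- bag q \<inter> U \<subseteq> - bag v \<inter> U" using q(3) by (auto simp: bag_def)
        then show ?thesis using vq q(1) Some by (simp add: Y_def rank_def)
      qed
    qed
  next
    have "(\<Sum>z\<in>UNIV. f z - f (parent z)) = (\<Sum>v\<in>UNIV. f (Some v) - f (parent (Some v)))"
      by (simp add: UNIV_option_conv sum.reindex f_def)
    also have "\<dots> \<le> (\<Sum>v\<in>UNIV. lookup \<alpha> v)"
    proof (rule sum_mono)
      fix v
      \<comment> \<open>As \<open>later v\<close> is empty or inside the bag of the parent, the
        increase at \<open>v\<close> is at most the exponent of \<alpha> at \<open>v\<close>. These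
        exponents sum to \<open>s\<close>.\<close>
      have fv: "f (Some v) = lookup \<alpha> v + weight \<alpha> (later v)"
        unfolding f_def option.case bag_def weight_def
        by (rule sum.insert) (auto simp: later_def)
      show "f (Some v) - f (parent (Some v)) \<le> lookup \<alpha> v"
      proof (rule parent_cases[of v])
        assume "later v = {}"
        then show ?thesis using fv by (simp add: weight_def)
      next
        fix q assume q: "parent (Some v) = Some q" "later v \<subseteq> bag q"
        then have "weight \<alpha> (later v) \<le> f (parent (Some v))"
          by (simp add: f_def weight_mono)
        then show ?thesis using fv by simp
      qed
    qed
    also have "\<dots> = s" using s by (simp add: mdegree_def)
    finally show "(\<Sum>z\<in>UNIV. f z - f (parent z)) \<le> d" using d by simp
  qed
  moreover have "(\<forall>z. f z \<le> weight w (Y z)) \<longleftrightarrow> (\<forall>v. s \<le> weight (w + \<alpha>) (- bag v))"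
    if "keys w \<subseteq> U" for w
  proof -
    have "s \<le> weight (w + \<alpha>) (- bag v) \<longleftrightarrow> weight \<alpha> (bag v) \<le> weight w (- bag v)" for v
      using weight_Compl[of \<alpha> "bag v"] s by (auto simp: weight_add)
    then show ?thesis
      by (simp add: f_def Y_def split_option_all weight_Int_keys[OF that])
  qed
  then have "{w. keys w \<subseteq> U \<and> (\<forall>z. f z \<le> weight w (Y z))}
      = {w. keys w \<subseteq> U \<and> (\<forall>z. s \<le> weight (w + \<alpha>) (- bag z))}" by blast
  ultimately show ?thesis by simp
qed

text \<open>Placing units on the vertices in elimination order: \<open>\<alpha>\<close> is what has been placed so far.\<close>

lemma truncation_linear_elimination:
  assumes "\<And>u v. u \<in> U \<Longrightarrow> idx u \<le> idx v \<Longrightarrow> v \<in> U"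
    and "\<And>a u. a \<in> keys \<alpha> \<Longrightarrow> u \<in> U \<Longrightarrow> idx a \<le> idx u"
    and "mdegree \<alpha> \<le> s" and "2 * s \<le> d + mdegree \<alpha>"
  shows "truncation_linear {w. keys w \<subseteq> U \<and> (\<forall>z. s \<le> weight (w + \<alpha>) (- bag z))} d"
  using assms
proof (induction "card U + (s - mdegree \<alpha>)" arbitrary: U \<alpha> d rule: less_induct)
  case less
  let ?e = "\<lambda>x. Poly_Mapping.single x (1::nat)"
  let ?L = "\<lambda>U \<alpha>. {w. keys w \<subseteq> U \<and> (\<forall>z. s \<le> weight (w + \<alpha>) (- bag z))}"
  show ?case
  proof (cases "mdegree \<alpha> = s")
    case True
    then show ?thesis using less.prems by (intro truncation_linear_placed) auto
  next
    case False
    then have lt: "mdegree \<alpha> < s" using less.prems(3) by simp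
    show ?thesis
    proof (cases "U = {}")
      case True
      \<comment> \<open>Only the monomial 1 is left for \<open>w\<close>, and \<alpha> alone has
        degree below \<open>s\<close>.\<close>
      have "\<not> s \<le> weight \<alpha> (- bag undefined)"
        using lt weight_le_mdegree[of \<alpha> "- bag undefined"] by simp
      then have "w \<notin> ?L U \<alpha>" for w using True by auto
      then have "?L U \<alpha> = {}" by blast
      then show ?thesis by (simp only: truncation_linear_empty)
    next
      case False
      obtain x where x: "x \<in> U" "\<forall>u\<in>U. idx x \<le> idx u" using exists_minimum[OF False] .
      \<comment> \<open>The degree \<open>d\<close> is positive because
        \<open>2 * s \<le> d + mdegree \<alpha>\<close> and \<open>mdegree \<alpha> < s\<close>.
        Dividing by \<open>x\<close> moves one unit from \<open>d\<close> to \<alpha>, which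
        preserves the inequality; once \<alpha> has degree \<open>s\<close> it reads
        \<open>s \<le> d\<close>.\<close>
      obtain d' where d: "d = Suc d'" using less.prems(4) lt by (cases d) auto
      show ?thesis unfolding d
      proof (rule truncation_linear_split[where x = x])
        have "truncation_linear (?L U (\<alpha> + ?e x)) d'"
        proof (rule less.hyps)
          show "card U + (s - mdegree (\<alpha> + ?e x)) < card U + (s - mdegree \<alpha>)"
            using lt by (simp add: mdegree_add)
          show "v \<in> U" if "u \<in> U" "idx u \<le> idx v" for u v using less.prems(1) that .
          \<comment> \<open>The vertex \<open>x\<close> stays in \<open>U\<close> and may receive
            more units; being the first of \<open>U\<close>, it precedes all others there.\<close>
          show "idx a \<le> idx u" if "a \<in> keys (\<alpha> + ?e x)" "u \<in> U" for a u
            using that less.prems(2) x(2) by (auto simp: keys_add_single)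
        qed (use lt less.prems(4) d in \<open>simp_all add: mdegree_add\<close>)
        moreover have "{w. w + ?e x \<in> ?L U \<alpha>} = ?L U (\<alpha> + ?e x)"
          using x(1) by (simp add: keys_add_single add_ac)
        ultimately show "truncation_linear {w. w + ?e x \<in> ?L U \<alpha>} d'" by simp
        have "truncation_linear (?L (U - {x}) \<alpha>) (Suc d')"
        proof (rule less.hyps)
          show "card (U - {x}) + (s - mdegree \<alpha>) < card U + (s - mdegree \<alpha>)"
            using x(1) card_Diff1_less[of U x] by simp
          show "v \<in> U - {x}" if "u \<in> U - {x}" "idx u \<le> idx v" for u v
          proof -
            have "v \<noteq> x" using that x(2)[rule_format, of u] inj by (metis DiffE injD insertI1 le_antisym)
            then show ?thesis using that less.prems(1) by blast
          qed
          show "idx a \<le> idx u" if "a \<in> keys \<alpha>" "u \<in> U - {x}" for a u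
            using that less.prems(2) by blast
        qed (use less.prems d in simp_all)
        moreover have "{w \<in> ?L U \<alpha>. lookup w x = 0} = ?L (U - {x}) \<alpha>" by (auto simp: in_keys_iff)
        ultimately show "truncation_linear {w \<in> ?L U \<alpha>. lookup w x = 0} (Suc d')" by simp
        show "w + ?e x \<in> ?L U \<alpha>" if w: "w \<in> ?L U \<alpha>" for w
        proof -
          have "weight (w + \<alpha>) (- bag z) \<le> weight (w + ?e x + \<alpha>) (- bag z)" for z
            by (simp add: weight_add)
          moreover have "keys (w + ?e x) \<subseteq> U" using w x(1) by (simp add: keys_add_single)
          ultimately show ?thesis using w order_trans by blast
        qed
      qed
    qed
  qed
qed

section \<open>Squarefree monomials on independent sets\<close>

definition independent_monomials :: "'v set \<Rightarrow> nat \<Rightarrow> ('v \<Rightarrow>\<^sub>0 nat) set" where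
  "independent_monomials U d = {m. keys m \<subseteq> U \<and> mdegree m = d \<and> (\<forall>v. lookup m v \<le> 1) \<and>
     (\<forall>a\<in>keys m. \<forall>b\<in>keys m. \<not> adj a b)}"

text \<open>Split on the first vertex \<open>x\<close> of \<open>U\<close>. A monomial without
  \<open>x\<close> involves at most one later neighbour of \<open>x\<close>, since these form a
  clique. Removing that one, or any vertex if there is none, leaves a monomial that may be
  multiplied by \<open>x\<close>; this is the exchange.\<close>

lemma independent_linear_quotients:
  "\<exists>ms. linear_quotients ms \<and> set ms = independent_monomials U d"
proof (induction "card U" arbitrary: U d rule: less_induct)
  case less
  let ?e = "\<lambda>x. Poly_Mapping.single x (1::nat)"
  show ?case
  proof (cases d)
    case 0
    have "independent_monomials U d = set [0]"
      by (auto simp: independent_monomials_def mdegree_eq_0 0)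
    then show ?thesis using linear_quotients_singleton by metis
  next
    case (Suc d')
    show ?thesis
    proof (cases "U = {}")
      case True
      have "m \<notin> independent_monomials U d" for m
        using True Suc mdegree_eq_0[of m] by (auto simp: independent_monomials_def)
      then have "independent_monomials U d = set []" by auto
      then show ?thesis using linear_quotients_Nil by metis
    next
      case False
      obtain x where x: "x \<in> U" "\<forall>u\<in>U. idx x \<le> idx u" using exists_minimum[OF False] .
      have later_x: "u \<in> later x" if "u \<in> U" "adj x u" for u
      proof -
        have "u \<noteq> x" using that irrefl by blast
        then have "idx u \<noteq> idx x" using inj by (metis injD)
        then show ?thesis using x(2)[rule_format, OF that(1)] that(2) by (simp add: later_def)
      qed
      have "card (U - bag x) < card U"
        using x(1) by (intro psubset_card_mono) (auto simp: bag_def)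
      from less[OF this] obtain us where us: "linear_quotients us" "set us = independent_monomials (U - bag x) d'"
        by blast
      have "card (U - {x}) < card U" using x(1) by (intro psubset_card_mono) auto
      from less[OF this] obtain vs where vs: "linear_quotients vs" "set vs = independent_monomials (U - {x}) d"
        by blast
      have "linear_quotients (map (\<lambda>u. u + ?e x) us @ vs)"
      proof (rule linear_quotients_append[OF us(1) vs(1)])
        show "lookup v x = 0" if "v \<in> set vs" for v
          using that by (auto simp: vs(2) independent_monomials_def in_keys_iff)
        fix v assume "v \<in> set vs"
        then have v: "keys v \<subseteq> U - {x}" "mdegree v = Suc d'" "\<And>a. lookup v a \<le> 1"
          "\<And>a b. a \<in> keys v \<Longrightarrow> b \<in> keys v \<Longrightarrow> \<not> adj a b"
          by (auto simp: vs(2) independent_monomials_def Suc)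
        have "v \<noteq> 0" using v(2) mdegree_eq_0[of v] by auto
        then obtain y0 where y0: "y0 \<in> keys v" by (metis all_not_in_conv keys_eq_empty)
        obtain y where y: "y \<in> keys v" "keys v \<inter> later x \<subseteq> {y}"
        proof (cases "keys v \<inter> later x = {}")
          case True
          then show ?thesis using that y0 by blast
        next
          case False
          then obtain y where y: "y \<in> keys v" "y \<in> later x" by blast
          have "a = y" if "a \<in> keys v" "a \<in> later x" for a
            using that y v(4)[of a y] later_clique[of x a y] by (auto simp: later_def)
          then show ?thesis using that y by blast
        qed
        obtain u where u: "v = u + ?e y"
          using exists_minus_single[of v y] y(1) by (auto simp: in_keys_iff)
        have uy: "lookup u y = 0" using v(3)[of y] by (simp add: u lookup_add)
        have sub: "keys u \<subseteq> keys v" by (auto simp: u keys_add_single)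
        have "u \<in> independent_monomials (U - bag x) d'"
          unfolding independent_monomials_def
        proof (intro CollectI conjI ballI allI)
          have "y \<notin> keys u" using uy by (simp add: in_keys_iff)
          then show "keys u \<subseteq> U - bag x" using v(1) y(2) sub unfolding bag_def by blast
          show "mdegree u = d'" using v(2) by (simp add: u mdegree_add)
          show "lookup u a \<le> 1" for a using v(3)[of a] by (simp add: u lookup_add)
          show "\<not> adj a b" if "a \<in> keys u" "b \<in> keys u" for a b using that sub v(4) by blast
        qed
        then show "\<exists>u\<in>set us. \<exists>y. v = u + ?e y" using u us(2) by blast
      qed
      moreover have "set (map (\<lambda>u. u + ?e x) us @ vs) = independent_monomials U d"
      proof
        have "u + ?e x \<in> independent_monomials U d" if "u \<in> independent_monomials (U - bag x) d'" for u
        proof -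
          have u: "keys u \<subseteq> U - bag x" "mdegree u = d'" "\<And>a. lookup u a \<le> 1"
            "\<And>a b. a \<in> keys u \<Longrightarrow> b \<in> keys u \<Longrightarrow> \<not> adj a b"
            using that by (auto simp: independent_monomials_def)
          have ux: "lookup u x = 0" using u(1) by (auto simp: bag_def in_keys_iff)
          have nadj: "\<not> adj x a" "\<not> adj a x" if "a \<in> keys u" for a
            using that u(1) later_x[of a] sym[of a x] by (auto simp: bag_def)
          show ?thesis
            unfolding independent_monomials_def
          proof (intro CollectI conjI ballI allI)
            show "keys (u + ?e x) \<subseteq> U" using u(1) x(1) by (auto simp: keys_add_single)
            show "mdegree (u + ?e x) = d" using u(2) Suc by (simp add: mdegree_add)
            show "lookup (u + ?e x) v \<le> 1" for v using u(3)[of v] ux by (auto simp: lookup_add_single)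
            show "\<not> adj a b" if "a \<in> keys (u + ?e x)" "b \<in> keys (u + ?e x)" for a b
            proof -
              have "a = x \<or> a \<in> keys u" "b = x \<or> b \<in> keys u" using that by (simp_all add: keys_add_single)
              then show ?thesis using u(4) nadj irrefl by blast
            qed
          qed
        qed
        moreover have "independent_monomials (U - {x}) d \<subseteq> independent_monomials U d"
          by (auto simp: independent_monomials_def)
        ultimately show "set (map (\<lambda>u. u + ?e x) us @ vs) \<subseteq> independent_monomials U d"
          by (auto simp: us(2) vs(2))
        show "independent_monomials U d \<subseteq> set (map (\<lambda>u. u + ?e x) us @ vs)"
        proof
          fix m assume "m \<in> independent_monomials U d"
          then have m: "keys m \<subseteq> U" "mdegree m = Suc d'" "\<And>a. lookup m a \<le> 1"
            "\<And>a b. a \<in> keys m \<Longrightarrow> b \<in> keys m \<Longrightarrow> \<not> adj a b"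
            by (auto simp: independent_monomials_def Suc)
          show "m \<in> set (map (\<lambda>u. u + ?e x) us @ vs)"
          proof (cases "lookup m x = 0")
            case True
            then have "m \<in> independent_monomials (U - {x}) d"
              using m Suc by (auto simp: independent_monomials_def in_keys_iff)
            then show ?thesis by (simp add: vs(2))
          next
            case False
            then obtain u where u: "m = u + ?e x" using exists_minus_single[of m x] by auto
            have keys_m: "keys m = insert x (keys u)" by (simp add: u keys_add_single)
            have "lookup u x = 0" using m(3)[of x] by (simp add: u lookup_add)
            then have "x \<notin> keys u" by (simp add: in_keys_iff)
            moreover have "a \<notin> later x" if "a \<in> keys u" for a
              using m(4)[of x a] that keys_m by (auto simp: later_def)
            ultimately have "keys u \<subseteq> U - bag x" using m(1) keys_m by (auto simp: bag_def)
            moreover have "lookup u a \<le> 1" for a using m(3)[of a] by (auto simp: u lookup_add)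
            moreover have "mdegree u = d'" using m(2) by (simp add: u mdegree_add)
            ultimately have "u \<in> set us"
              using m(4) keys_m by (auto simp: us(2) independent_monomials_def)
            then show ?thesis by (simp add: u)
          qed
        qed
      qed
      ultimately show ?thesis by blast
    qed
  qed
qed

end


section \<open>Perfect elimination orders of chordal graphs\<close>

locale chordal_graph =
  fixes H :: "'v set set"
  assumes simple: "simple_graph H" and chordal: "chordal H"
begin

definition adj :: "'v \<Rightarrow> 'v \<Rightarrow> bool" where
  "adj u v \<longleftrightarrow> {u, v} \<in> H"

lemma adj_sym: "adj u v \<Longrightarrow> adj v u"
  by (simp add: adj_def insert_commute)

lemma adj_irrefl: "\<not> adj v v"
  using simple by (auto simp: adj_def simple_graph_def)

section \<open>Shortest walks and induced cycles\<close>

lemma walk_in: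
  assumes "(a, b) \<in> {(u, v). adj u v \<and> u \<in> W \<and> v \<in> W}\<^sup>*" "a \<in> W"
  shows "\<exists>ws. ws \<noteq> [] \<and> hd ws = a \<and> last ws = b \<and> successively adj ws \<and> set ws \<subseteq> W"
  using assms(1)
proof induction
  case base
  then show ?case using assms(2) by (intro exI[of _ "[a]"]) auto
next
  case (step y z)
  then obtain ws where "ws \<noteq> []" "hd ws = a" "last ws = y" "successively adj ws" "set ws \<subseteq> W" by blast
  then show ?case using step(2)
    by (intro exI[of _ "ws @ [z]"]) (auto simp: successively_append_iff)
qed

text \<open>At a repeated vertex or a chord, the part of the walk in between could be cut
  out.\<close>

lemma shortest_walk_induced:
  assumes ws: "ws \<noteq> []" "hd ws = s" "last ws = t" "successively adj ws" "set ws \<subseteq> W"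
    and least: "\<And>us. us \<noteq> [] \<Longrightarrow> hd us = s \<Longrightarrow> last us = t \<Longrightarrow> successively adj us \<Longrightarrow> set us \<subseteq> W
      \<Longrightarrow> length ws \<le> length us"
    and ab: "a < b" "b < length ws"
  shows "ws ! a \<noteq> ws ! b \<and> (adj (ws ! a) (ws ! b) \<longleftrightarrow> b = Suc a)"
proof -
  have parts: "successively adj (take c ws)" "successively adj (drop c ws)" for c
    using ws(4) successively_append_iff[of adj "take c ws" "drop c ws"] by auto
  have sub: "set (take c ws) \<subseteq> W" "set (drop c ws) \<subseteq> W" for c
    using ws(5) set_take_subset[of c ws] set_drop_subset[of c ws] by blast+
  have next_adj: "adj (ws ! c) (ws ! Suc c)" if "Suc c < length ws" for c
    using ws(4) that by (simp add: successively_conv_nth)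
  \<comment> \<open>The first \<open>c\<close> vertices are followed directly by those from position
    \<open>b\<close> on; for \<open>c = 0\<close> the new walk starts at
    \<open>ws ! b\<close>.\<close>
  have shortcut: "length ws \<le> length us"
    if "us = take c ws @ drop b ws" "c \<le> a" "c = 0 \<Longrightarrow> ws ! b = s"
      "c > 0 \<Longrightarrow> adj (ws ! (c - 1)) (ws ! b)" for us c
  proof (rule least)
    have hdb: "hd (drop b ws) = ws ! b" using ab by (simp add: hd_drop_conv_nth)
    show "us \<noteq> []" using that(1) ab by simp
    show "hd us = s"
      using that(1-3) hdb ws(1,2) ab by (cases "c = 0") (auto simp: hd_append)
    show "last us = t" using that(1) ab ws(3) by (simp add: last_append last_drop)
    have "last (take c ws) = ws ! (c - 1)" if "c > 0"
      using that \<open>c \<le> a\<close> ab by (subst last_conv_nth) auto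
    then show "successively adj us"
      using that(1,4) hdb parts by (auto simp: successively_append_iff)
    show "set us \<subseteq> W" using that(1) sub by auto
  qed
  have "ws ! a \<noteq> ws ! b"
  proof
    assume eq: "ws ! a = ws ! b"
    have "length ws \<le> length (take a ws @ drop b ws)"
    proof (rule shortcut[OF refl])
      show "ws ! b = s" if "a = 0" using that eq ws(1,2) by (simp add: hd_conv_nth)
      show "adj (ws ! (a - 1)) (ws ! b)" if "a > 0" using next_adj[of "a - 1"] that ab eq by simp
    qed simp
    then show False using ab by simp
  qed
  moreover have "\<not> adj (ws ! a) (ws ! b)" if "b \<noteq> Suc a"
  proof
    assume adj: "adj (ws ! a) (ws ! b)"
    have len: "length ws \<le> length us" if "us = take (Suc a) ws @ drop b ws" for us
    proof (rule least)
      have hdb: "hd (drop b ws) = ws ! b" using ab by (simp add: hd_drop_conv_nth)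
      show "us \<noteq> []" "hd us = s" using that ab ws(1,2) by (auto simp: hd_append)
      show "last us = t" using that ab ws(3) by (simp add: last_append last_drop)
      have "last (take (Suc a) ws) = ws ! a" using ab by (subst last_conv_nth) auto
      then show "successively adj us"
        using that adj hdb parts by (auto simp: successively_append_iff)
      show "set us \<subseteq> W" using that sub by auto
    qed
    then show False using ab that len[OF refl] by simp
  qed
  ultimately show ?thesis using next_adj[of a] ab by auto
qed

text \<open>Otherwise a shortest walk from \<open>s\<close> to \<open>t\<close> through
  \<open>A\<close> is induced and has an inner vertex. Its inner vertices are not adjacent to
  \<open>v\<close>, so together with \<open>v\<close> it is an induced cycle of length at least
  four.\<close>

lemma common_neighbours_adjacent:
  assumes vs: "adj v s" and vt: "adj v t" and st: "s \<noteq> t"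
    and A: "\<And>c. c \<in> A \<Longrightarrow> c \<noteq> v \<and> \<not> adj v c"
    and c: "c \<in> A" "adj c s" "adj c' t"
    and conn: "(c, c') \<in> {(u, v). adj u v \<and> u \<in> A \<and> v \<in> A}\<^sup>*"
  shows "adj s t"
proof (rule ccontr)
  assume nst: "\<not> adj s t"
  let ?W = "insert s (insert t A)"
  define Q where "Q ws \<longleftrightarrow> ws \<noteq> [] \<and> hd ws = s \<and> last ws = t \<and> successively adj ws \<and> set ws \<subseteq> ?W" for ws
  obtain us where "us \<noteq> []" "hd us = c" "last us = c'" "successively adj us" "set us \<subseteq> A"
    using walk_in[OF conn c(1)] by blast
  then have "Q (s # us @ [t])"
    using c(2,3) adj_sym unfolding Q_def by (auto simp: successively_Cons successively_append_iff)
  then obtain ws where ws: "Q ws" and least: "\<And>us. Q us \<Longrightarrow> length ws \<le> length us"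
    using ex_has_least_nat[of Q _ length] by blast
  have Q: "ws \<noteq> []" "hd ws = s" "last ws = t" "successively adj ws" "set ws \<subseteq> ?W"
    using ws by (simp_all add: Q_def)
  have induced: "ws ! a \<noteq> ws ! b" "adj (ws ! a) (ws ! b) \<longleftrightarrow> b = Suc a" if "a < b" "b < length ws" for a b
    using shortest_walk_induced[OF Q _ that] least by (simp_all add: Q_def)
  define n where "n = length ws"
  have first: "ws ! 0 = s" and final: "ws ! (n - 1) = t"
    using Q(1-3) by (simp_all add: n_def hd_conv_nth last_conv_nth)
  have "n \<noteq> 0" using Q(1) by (simp add: n_def)
  moreover have "n \<noteq> 1" using first final st by auto
  moreover have "n \<noteq> 2" using induced(2)[of 0 1] first final nst by (auto simp: n_def)
  ultimately have n: "n \<ge> 3" by simp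
  have ends: "b = 0 \<or> b = n - 1" if "b < n" "ws ! b = s \<or> ws ! b = t" for b
    using that(2)
  proof
    assume "ws ! b = s"
    then show ?thesis using induced(1)[of 0 b] that(1) first by (cases "b = 0") (auto simp: n_def)
  next
    assume "ws ! b = t"
    moreover have "n - 1 < length ws" using n by (simp add: n_def)
    ultimately show ?thesis
      using induced(1)[of b "n - 1"] that(1) final by (cases "b < n - 1") auto
  qed
  have v_adj: "adj v (ws ! b) \<longleftrightarrow> b = 0 \<or> b = n - 1" if "b < n" for b
  proof
    assume "adj v (ws ! b)"
    then have "ws ! b \<notin> A" using A by blast
    moreover have "ws ! b \<in> ?W" using Q(5) that nth_mem[of b ws] unfolding n_def by blast
    ultimately show "b = 0 \<or> b = n - 1" using ends[OF that] by blast
  qed (use first final vs vt in auto)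
  have v_notin: "v \<notin> set ws"
    using Q(5) A vs vt adj_irrefl by blast
  \<comment> \<open>In \<open>v # ws\<close> the vertex \<open>v\<close> has index 0 and position
    \<open>a\<close> of the walk has index \<open>Suc a\<close>; the wrap-around at index
    \<open>n\<close> is the edge from \<open>t\<close> back to \<open>v\<close>.\<close>
  have edges: "{(v # ws) ! i, (v # ws) ! j} \<in> H \<longleftrightarrow> j = Suc i mod Suc n \<or> i = Suc j mod Suc n"
    if ij: "i < j" "j < Suc n" for i j
  proof -
    obtain b where b: "j = Suc b" "b < n" using ij by (cases j) auto
    show ?thesis
    proof (cases i)
      case 0
      have "(Suc j mod Suc n = 0) = (j = n)" using ij by (auto simp: mod_Suc)
      then show ?thesis using v_adj[OF b(2)] 0 b n by (auto simp: adj_def)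
    next
      case (Suc a)
      have "Suc i mod Suc n = Suc i" using ij by simp
      moreover have "i \<noteq> Suc j mod Suc n" using ij Suc by (cases "j = n") auto
      ultimately show ?thesis using induced(2)[of a b] Suc b ij by (auto simp: adj_def n_def)
    qed
  qed
  have "induced_cycle H (v # ws)"
    unfolding induced_cycle_def
  proof (intro conjI allI impI)
    show "3 \<le> length (v # ws)" using n by (simp add: n_def)
    have "distinct ws"
      unfolding distinct_conv_nth using induced(1) by (metis linorder_neqE_nat)
    then show "distinct (v # ws)" using v_notin by simp
    fix i j assume ij: "i < length (v # ws)" "j < length (v # ws)"
    have len: "length (v # ws) = Suc n" by (simp add: n_def)
    consider "i < j" | "j < i" | "i = j" by linarith
    then show "{(v # ws) ! i, (v # ws) ! j} \<in> H \<longleftrightarrow>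
      j = Suc i mod length (v # ws) \<or> i = Suc j mod length (v # ws)"
    proof cases
      case 1
      then show ?thesis using edges[OF 1] ij len by simp
    next
      case 2
      then show ?thesis using edges[OF 2] ij len by (simp add: insert_commute disj_commute)
    next
      case 3
      have "i \<noteq> Suc i mod Suc n" using ij n len by (cases "i = n") auto
      moreover have "{(v # ws) ! i, (v # ws) ! i} \<notin> H" using adj_irrefl[of "(v # ws) ! i"] by (simp only: adj_def) simp
      ultimately show ?thesis using 3 len by simp
    qed
  qed
  moreover have "4 \<le> length (v # ws)" using n by (simp add: n_def)
  ultimately show False using chordal unfolding chordal_def by blast
qed

section \<open>Simplicial vertices and Dirac's theorem\<close>

definition simplicial :: "'v set \<Rightarrow> 'v \<Rightarrow> bool" where
  "simplicial U w \<longleftrightarrow> (\<forall>a\<in>U. \<forall>b\<in>U. adj w a \<longrightarrow> adj w b \<longrightarrow> a \<noteq> b \<longrightarrow> adj a b)"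

text \<open>Let \<open>C\<close> be the component of \<open>w\<close> among the non-neighbours of
  \<open>v\<close>, and \<open>S\<close> the set of its outside neighbours. All of \<open>S\<close>
  is adjacent to \<open>v\<close>, so \<open>S\<close> is a clique by
  \<open>common_neighbours_adjacent\<close>. A vertex of \<open>C\<close> that is simplicial in
  \<open>C \<union> S\<close> is simplicial in \<open>U\<close>, as all its neighbours in
  \<open>U\<close> lie in \<open>C \<union> S\<close>; induction applies because \<open>v\<close> is
  missing there.\<close>

lemma simplicial_nonneighbour:
  assumes "finite U" "v \<in> U" "w \<in> U" "w \<noteq> v" "\<not> adj v w"
  shows "\<exists>x\<in>U. x \<noteq> v \<and> \<not> adj v x \<and> simplicial U x"
  using assms
proof (induction "card U" arbitrary: U v w rule: less_induct)
  case less
  define A where "A = {a \<in> U. a \<noteq> v \<and> \<not> adj v a}"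
  let ?R = "{(a, b). adj a b \<and> a \<in> A \<and> b \<in> A}"
  define C where "C = {c. (w, c) \<in> ?R\<^sup>*}"
  define S where "S = {s \<in> U. s \<notin> C \<and> (\<exists>c\<in>C. adj c s)}"
  have wA: "w \<in> A" using less.prems by (simp add: A_def)
  have CA: "C \<subseteq> A"
  proof
    fix c assume "c \<in> C"
    then have "(w, c) \<in> ?R\<^sup>*" by (simp add: C_def)
    then show "c \<in> A" by (induction) (use wA in auto)
  qed
  have symR: "sym ?R" using adj_sym by (auto simp: sym_def)
  have S_v: "adj v s" if s: "s \<in> S" for s
  proof -
    obtain c where c: "c \<in> C" "adj c s" "s \<in> U" "s \<notin> C" using s by (auto simp: S_def)
    have "s \<noteq> v" using c CA adj_sym by (auto simp: A_def)
    moreover have "s \<notin> A"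
    proof
      assume "s \<in> A"
      then have "(c, s) \<in> ?R" using c CA by auto
      then show False using c by (auto simp: C_def intro: rtrancl_into_rtrancl)
    qed
    ultimately show ?thesis using c by (auto simp: A_def)
  qed
  have S_clique: "adj s t" if st: "s \<in> S" "t \<in> S" "s \<noteq> t" for s t
  proof -
    obtain c c' where c: "c \<in> C" "adj c s" "c' \<in> C" "adj c' t" using st by (auto simp: S_def)
    have "(c, w) \<in> ?R\<^sup>*" "(w, c') \<in> ?R\<^sup>*"
      using c sym_rtrancl[OF symR] by (auto simp: C_def sym_def)
    then have "(c, c') \<in> ?R\<^sup>*" by simp
    then show ?thesis
      using common_neighbours_adjacent[of v s t A c c'] S_v st c CA by (auto simp: A_def)
  qed
  define U' where "U' = C \<union> S"
  have sub: "U' \<subseteq> U - {v}" using CA S_v adj_irrefl less.prems(2) by (auto simp: U'_def A_def S_def)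
  have fin: "finite U'" using sub less.prems(1) by (meson finite_Diff finite_subset)
  have card: "card U' < card U" using sub less.prems(1,2) by (intro psubset_card_mono) auto
  have "\<exists>x\<in>C. simplicial U' x"
  proof (cases "\<forall>a\<in>U'. \<forall>b\<in>U'. a \<noteq> b \<longrightarrow> adj a b")
    case True
    moreover have "w \<in> C" by (simp add: C_def)
    ultimately show ?thesis by (auto simp: simplicial_def)
  next
    case False
    then obtain a b where ab: "a \<in> U'" "b \<in> U'" "b \<noteq> a" "\<not> adj a b" by blast
    \<comment> \<open>The induction hypothesis may be needed twice: if the simplicial vertex
      \<open>x\<close> lies in the clique \<open>S\<close>, then a second one not adjacent to
      \<open>x\<close> lies in \<open>C\<close>.\<close>
    obtain x where x: "x \<in> U'" "x \<noteq> a" "\<not> adj a x" "simplicial U' x"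
      using less.hyps[OF card fin ab] by blast
    show ?thesis
    proof (cases "x \<in> C")
      case True
      then show ?thesis using x by blast
    next
      case False
      then have xS: "x \<in> S" using x by (simp add: U'_def)
      obtain y where y: "y \<in> U'" "y \<noteq> x" "\<not> adj x y" "simplicial U' y"
        using less.hyps[OF card fin x(1) ab(1)] x adj_sym by blast
      then have "y \<in> C" using S_clique[OF xS] by (auto simp: U'_def)
      then show ?thesis using y by blast
    qed
  qed
  then obtain x where x: "x \<in> C" "simplicial U' x" by blast
  have "a \<in> U'" if "a \<in> U" "adj x a" for a using that x(1) by (auto simp: U'_def S_def)
  then have "simplicial U x" using x(2) by (auto simp: simplicial_def)
  then show ?case using x(1) CA by (auto simp: A_def)
qed

lemma exists_simplicial:
  assumes "finite U" "U \<noteq> {}"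
  shows "\<exists>x\<in>U. simplicial U x"
proof (cases "\<exists>v\<in>U. \<exists>w\<in>U. w \<noteq> v \<and> \<not> adj v w")
  case True
  then show ?thesis using simplicial_nonneighbour[OF assms(1)] by blast
next
  case False
  have "simplicial U x" for x
    unfolding simplicial_def
  proof (intro ballI impI)
    show "adj a b" if "a \<in> U" "b \<in> U" "a \<noteq> b" for a b using False that by auto
  qed
  then show ?thesis using assms(2) by blast
qed

lemma exists_perfect_elimination:
  assumes "finite U"
  shows "\<exists>idx :: 'v \<Rightarrow> nat. inj_on idx U \<and> (\<forall>u\<in>U. \<forall>v\<in>U. \<forall>w\<in>U. adj u v \<longrightarrow> adj u w \<longrightarrow>
    idx u < idx v \<longrightarrow> idx u < idx w \<longrightarrow> v \<noteq> w \<longrightarrow> adj v w)"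
  using assms
proof (induction "card U" arbitrary: U)
  case 0
  then show ?case by simp
next
  case (Suc n)
  then have "U \<noteq> {}" by auto
  then obtain x where x: "x \<in> U" "simplicial U x" using exists_simplicial[OF Suc.prems] by blast
  have "n = card (U - {x})" "finite (U - {x})" using Suc.hyps(2) Suc.prems x(1) by simp_all
  from Suc(1)[OF this] obtain idx :: "'v \<Rightarrow> nat" where idx: "inj_on idx (U - {x})"
    "\<And>u v w. u \<in> U - {x} \<Longrightarrow> v \<in> U - {x} \<Longrightarrow> w \<in> U - {x} \<Longrightarrow> adj u v \<Longrightarrow> adj u w \<Longrightarrow>
      idx u < idx v \<Longrightarrow> idx u < idx w \<Longrightarrow> v \<noteq> w \<Longrightarrow> adj v w"
    by blast
  \<comment> \<open>The simplicial vertex is put first and the order of the others is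
    shifted.\<close>
  show ?case
  proof (intro exI[of _ "\<lambda>u. if u = x then 0 else Suc (idx u)"] conjI ballI impI)
    show "inj_on (\<lambda>u. if u = x then 0 else Suc (idx u)) U"
      using idx(1) by (auto simp: inj_on_def)
    fix u v w assume uvw: "u \<in> U" "v \<in> U" "w \<in> U" "adj u v" "adj u w" "v \<noteq> w"
      "(if u = x then 0 else Suc (idx u)) < (if v = x then 0 else Suc (idx v))"
      "(if u = x then 0 else Suc (idx u)) < (if w = x then 0 else Suc (idx w))"
    show "adj v w"
    proof (cases "u = x")
      case True
      then show ?thesis using x(2) uvw unfolding simplicial_def by blast
    next
      case False
      then have "v \<noteq> x" "w \<noteq> x" "idx u < idx v" "idx u < idx w" using uvw(7,8) by (auto split: if_splits)
      then show ?thesis by (intro idx(2)[of u v w]) (use uvw(1-6) False in blast)+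
    qed
  qed
qed

end


section \<open>Symbolic powers of edge ideals\<close>

lemma is_ideal_monomial:
  fixes A :: "('v \<Rightarrow>\<^sub>0 nat) set"
  assumes up: "\<And>m u. m \<in> A \<Longrightarrow> u + m \<in> A"
  shows "is_ideal {p :: ('v, 'k::field) mpoly. keys p \<subseteq> A}"
proof (rule ideal_subspaceI)
  show "x + y \<in> {p. keys p \<subseteq> A}" if "x \<in> {p. keys p \<subseteq> A}" "y \<in> {p. keys p \<subseteq> A}" for x y :: "('v, 'k) mpoly"
    using that keys_add[of x y] by blast
  show "c * x \<in> {p. keys p \<subseteq> A}" if "x \<in> {p. keys p \<subseteq> A}" for c x :: "('v, 'k) mpoly"
    using that keys_mult[of c x] up by blast
qed simp

text \<open>Weights add under products. Conversely, a variable of \<open>C\<close> can be split off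
  from each term of positive weight, and the remaining factor lies in the previous power.\<close>

lemma ideal_power_cover_ideal_prime:
  fixes p :: "('v::finite, 'k::field) mpoly"
  shows "p \<in> ideal_power (cover_ideal_prime C) s \<longleftrightarrow> (\<forall>m\<in>keys p. s \<le> weight m C)"
proof (induction s arbitrary: p)
  case 0
  then show ?case by simp
next
  case (Suc s)
  let ?G = "{a * b |a b. a \<in> (cover_ideal_prime C :: ('v, 'k) mpoly set) \<and> b \<in> ideal_power (cover_ideal_prime C) s}"
  let ?A = "{m. Suc s \<le> weight m C}"
  have "ideal_span ?G \<subseteq> {p. keys p \<subseteq> ?A}"
  proof (rule ideal_span_minimal)
    show "is_ideal {p :: ('v, 'k) mpoly. keys p \<subseteq> ?A}"
      by (rule is_ideal_monomial) (simp add: weight_add)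
    show "?G \<subseteq> {p. keys p \<subseteq> ?A}"
    proof safe
      fix a b :: "('v, 'k) mpoly" and m
      assume a: "a \<in> cover_ideal_prime C" and b: "b \<in> ideal_power (cover_ideal_prime C) s"
        and m: "m \<in> keys (a * b)"
      obtain u v where uv: "m = u + v" "u \<in> keys a" "v \<in> keys b" using m keys_mult[of a b] by blast
      obtain x where x: "x \<in> C" "lookup u x > 0"
        using a uv(2) unfolding cover_ideal_prime_def ideal_span_var by blast
      have "lookup u x \<le> weight u C" unfolding weight_def using x(1) by (intro member_le_sum) auto
      then show "Suc s \<le> weight m C" using b x(2) uv unfolding Suc by (force simp: weight_add)
    qed
  qed
  moreover have "p \<in> ideal_span ?G" if p: "\<forall>m\<in>keys p. Suc s \<le> weight m C" for p
  proof -
    have "Poly_Mapping.single m (lookup p m) \<in> ideal_span ?G" if m: "m \<in> keys p" for m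
    proof -
      have "weight m C \<noteq> 0" using p m by auto
      then obtain x where x: "x \<in> C" "lookup m x > 0" unfolding weight_def by (metis gr_zeroI sum.neutral)
      obtain u where u: "m = u + Poly_Mapping.single x 1" using exists_minus_single[OF x(2)] .
      have "s \<le> weight u C" using p m x(1) by (auto simp: u weight_add_single)
      then have "Poly_Mapping.single u (lookup p m) \<in> ideal_power (cover_ideal_prime C) s"
        unfolding Suc by simp
      moreover have "(var x :: ('v, 'k) mpoly) \<in> cover_ideal_prime C"
        unfolding cover_ideal_prime_def using x(1) by (intro ideal_span_base) simp
      ultimately have "var x * Poly_Mapping.single u (lookup p m) \<in> ideal_span ?G"
        by (intro ideal_span_base) blast
      then show ?thesis by (simp add: u var_eq_monom mult_single add.commute)
    qed
    then have "(\<Sum>m\<in>keys p. Poly_Mapping.single m (lookup p m)) \<in> ideal_span ?G"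
      by (rule ideal_span_sum)
    then show ?thesis by (simp only: poly_mapping_sum_monomials)
  qed
  ultimately show ?case by auto
qed

lemma exists_minimal_vertex_cover:
  fixes E :: "'v::finite set set"
  assumes "vertex_cover E C"
  obtains D where "D \<subseteq> C" "minimal_vertex_cover E D"
proof -
  obtain D where D: "D \<subseteq> C" "vertex_cover E D"
    and least: "\<And>D'. D' \<subseteq> C \<Longrightarrow> vertex_cover E D' \<Longrightarrow> card D \<le> card D'"
    using ex_has_least_nat[of "\<lambda>D. D \<subseteq> C \<and> vertex_cover E D" C card] assms by blast
  have "\<not> vertex_cover E D'" if "D' \<subset> D" for D'
    using least[of D'] psubset_card_mono[of D D'] that D(1) by auto
  then show ?thesis using that D by (simp add: minimal_vertex_cover_def)
qed

section \<open>The monomials of the symbolic power\<close>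

context perfect_elimination
begin

lemma bag_clique: "a \<in> bag z \<Longrightarrow> b \<in> bag z \<Longrightarrow> a \<noteq> b \<Longrightarrow> adj a b"
  unfolding bag_def later_def using sym[of z a] later_clique[of z a b] by blast

lemma edge_in_bag:
  assumes "adj a b"
  obtains z where "a \<in> bag z" "b \<in> bag z"
proof (cases "idx a < idx b")
  case True
  then show ?thesis using assms that[of a] by (simp add: bag_def later_def)
next
  case False
  then have "idx b < idx a" using assms irrefl inj by (metis injD linorder_neqE_nat)
  then show ?thesis using sym[OF assms] that[of b] by (simp add: bag_def later_def)
qed

definition bag_monomials :: "nat \<Rightarrow> ('v \<Rightarrow>\<^sub>0 nat) set" where
  "bag_monomials s = {m. \<forall>z. s \<le> weight m (- bag z)}"

text \<open>Here \<open>adj\<close> is adjacency in the complement graph. Bags are cliques of it, so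
  their complements are vertex covers and contain minimal ones. The complement of a minimal vertex
  cover is a clique, hence lies in the bag of its first vertex. By monotonicity of the weight, bags
  and minimal covers impose the same conditions.\<close>

lemma symbolic_power_monomials:
  fixes p :: "('v, 'k::field) mpoly"
  assumes simple: "simple_graph E" and adj_E: "\<And>a b. adj a b \<longleftrightarrow> a \<noteq> b \<and> {a, b} \<notin> E"
  shows "p \<in> symbolic_power E s \<longleftrightarrow> (\<forall>m\<in>keys p. m \<in> bag_monomials s)"
proof -
  have to_bag: "s \<le> weight m (- bag z)" if m: "\<And>C. minimal_vertex_cover E C \<Longrightarrow> s \<le> weight m C" for m z
  proof -
    have "vertex_cover E (- bag z)"
      unfolding vertex_cover_def
    proof
      fix e assume e: "e \<in> E"
      then obtain a b where ab: "e = {a, b}" "a \<noteq> b"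
        using simple by (auto simp: simple_graph_def card_2_iff)
      then have "\<not> adj a b" using e by (simp add: adj_E)
      then show "e \<inter> - bag z \<noteq> {}" using bag_clique[of a z b] ab by blast
    qed
    then obtain D where "D \<subseteq> - bag z" "minimal_vertex_cover E D"
      by (rule exists_minimal_vertex_cover)
    then show ?thesis using m[of D] weight_mono[of D "- bag z" m] by simp
  qed
  have to_cover: "s \<le> weight m C" if m: "\<And>z. s \<le> weight m (- bag z)" and C: "minimal_vertex_cover E C" for m C
  proof -
    have ind: "adj a b" if "a \<notin> C" "b \<notin> C" "a \<noteq> b" for a b
      using C that by (auto simp: minimal_vertex_cover_def vertex_cover_def adj_E)
    obtain z where "- C \<subseteq> bag z"
    proof (cases "- C = {}")
      case True
      then show ?thesis using that by blast
    next
      case False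
      obtain z where z: "z \<in> - C" "\<forall>u\<in>- C. idx z \<le> idx u"
        using exists_minimum[OF False] .
      have "u \<in> bag z" if u: "u \<in> - C" for u
      proof (cases "u = z")
        case False
        then have "idx u \<noteq> idx z" using inj by (metis injD)
        then show ?thesis using z(2)[rule_format, OF u] ind[of z u] z(1) u False by (simp add: bag_def later_def)
      qed (simp add: bag_def)
      then show ?thesis using that by blast
    qed
    then have "- bag z \<subseteq> C" by blast
    then show ?thesis using m[of z] weight_mono[of "- bag z" C m] by simp
  qed
  have "m \<in> bag_monomials s \<longleftrightarrow> (\<forall>C. minimal_vertex_cover E C \<longrightarrow> s \<le> weight m C)" for m
    unfolding bag_monomials_def mem_Collect_eq using to_bag[of m] to_cover[of m] by metis
  moreover have "p \<in> symbolic_power E s \<longleftrightarrow>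
      (\<forall>C. minimal_vertex_cover E C \<longrightarrow> (\<forall>m\<in>keys p. s \<le> weight m C))"
    by (simp add: symbolic_power_def ideal_power_cover_ideal_prime)
  ultimately show ?thesis by simp blast
qed

lemma lookup_le_weight: "v \<in> S \<Longrightarrow> lookup m v \<le> weight m S"
  unfolding weight_def by (intro member_le_sum) auto

text \<open>If \<open>v\<close> occurs in \<open>m\<close>, then \<open>bag v\<close> has positive
  weight and its complement has weight at least \<open>s\<close>.\<close>

lemma bag_monomials_low_degree:
  assumes "m \<in> bag_monomials s" "s \<ge> 1"
  shows "s < mdegree m"
proof -
  have "mdegree m \<noteq> 0"
    using assms weight_le_mdegree[of m "- bag undefined"] by (auto simp: bag_monomials_def dest: spec[of _ undefined])
  then obtain v where v: "lookup m v > 0" unfolding mdegree_def by (metis gr_zeroI sum.neutral)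
  have "lookup m v \<le> weight m (bag v)" by (rule lookup_le_weight) (simp add: bag_def)
  moreover have "s \<le> weight m (- bag v)" using assms(1) by (simp add: bag_monomials_def)
  ultimately show ?thesis using weight_Compl[of m "bag v"] v by simp
qed

text \<open>In this degree every bag may have weight at most one. Each vertex and each edge lies in
  a bag, and vertices sharing a bag are adjacent, so exactly the squares and the adjacent pairs are
  excluded.\<close>

lemma bag_monomials_Suc:
  "{m \<in> bag_monomials s. mdegree m = Suc s} = independent_monomials UNIV (Suc s)"
proof -
  have compl: "(\<forall>z. s \<le> weight m (- bag z)) \<longleftrightarrow> (\<forall>z. weight m (bag z) \<le> 1)" if "mdegree m = Suc s" for m
  proof (rule iff_allI)
    show "s \<le> weight m (- bag z) \<longleftrightarrow> weight m (bag z) \<le> 1" for z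
      using weight_Compl[of m "bag z"] that by linarith
  qed
  have bags: "(\<forall>z. weight m (bag z) \<le> 1) \<longleftrightarrow>
      (\<forall>v. lookup m v \<le> 1) \<and> (\<forall>a\<in>keys m. \<forall>b\<in>keys m. \<not> adj a b)" for m
  proof (intro iffI conjI allI ballI notI)
    assume le: "\<forall>z. weight m (bag z) \<le> 1"
    show "lookup m v \<le> 1" for v
      using le lookup_le_weight[of v "bag v" m] order_trans by (fastforce simp: bag_def)
    fix a b assume ab: "a \<in> keys m" "b \<in> keys m" "adj a b"
    then obtain z where z: "a \<in> bag z" "b \<in> bag z" using edge_in_bag by blast
    have "a \<noteq> b" using ab irrefl by blast
    then have "lookup m a + lookup m b = weight m {a, b}" by (simp add: weight_def)
    also have "\<dots> \<le> weight m (bag z)" using z by (intro weight_mono) simp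
    finally show False using le[rule_format, of z] ab(1,2) by (simp add: in_keys_iff)
  next
    fix z assume m: "(\<forall>v. lookup m v \<le> 1) \<and> (\<forall>a\<in>keys m. \<forall>b\<in>keys m. \<not> adj a b)"
    show "weight m (bag z) \<le> 1"
    proof (cases "keys m \<inter> bag z = {}")
      case True
      then have "weight m (bag z) = 0" by (auto simp: weight_def in_keys_iff)
      then show ?thesis by simp
    next
      case False
      then obtain y where y: "y \<in> keys m" "y \<in> bag z" by blast
      have "lookup m v = 0" if "v \<in> bag z" "v \<noteq> y" for v
      proof (rule ccontr)
        assume "lookup m v \<noteq> 0"
        then have "v \<in> keys m" by (simp add: in_keys_iff)
        then show False using bag_clique[of v z y] that y m by blast
      qed
      then have "weight m (bag z) = weight m {y}"
        unfolding weight_def using y(2) by (intro sum.mono_neutral_right) auto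
      then show ?thesis using m by (simp add: weight_def)
    qed
  qed
  have "m \<in> bag_monomials s \<and> mdegree m = Suc s \<longleftrightarrow> m \<in> independent_monomials UNIV (Suc s)" for m
    unfolding bag_monomials_def independent_monomials_def mem_Collect_eq
    using compl[of m] bags[of m] by blast
  then show ?thesis by blast
qed

lemma bag_monomials_linear_quotients:
  assumes "d \<ge> 2 * s"
  obtains ms where "linear_quotients ms" "set ms = {m \<in> bag_monomials s. mdegree m = d}"
proof -
  \<comment> \<open>The elimination starts with all vertices available and nothing placed.\<close>
  have "truncation_linear {w. keys w \<subseteq> UNIV \<and> (\<forall>z. s \<le> weight (w + 0) (- bag z))} d"
    using assms by (intro truncation_linear_elimination) (auto simp: mdegree_def)
  then have "truncation_linear (bag_monomials s) d" by (simp add: bag_monomials_def)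
  then show ?thesis using that unfolding truncation_linear_def by blast
qed

text \<open>This provides the nonvanishing required by \<open>has_linear_resolution\<close>, with
  \<open>a\<close> and \<open>b\<close> the ends of an edge of the graph.\<close>

lemma bag_monomials_nonempty:
  assumes "d \<ge> 2 * s" "\<not> adj a b" "a \<noteq> b"
  shows "\<exists>m\<in>bag_monomials s. mdegree m = d"
proof (intro bexI)
  \<comment> \<open>No bag contains both \<open>a\<close> and \<open>b\<close>, and both exponents
    are at least \<open>s\<close>.\<close>
  let ?m = "Poly_Mapping.single a s + Poly_Mapping.single b (d - s)"
  show "mdegree ?m = d" using assms(1) by (simp add: mdegree_add)
  have "s \<le> weight ?m (- bag z)" for z
  proof -
    have "weight ?m (- bag z) = (if a \<in> - bag z then s else 0) + (if b \<in> - bag z then d - s else 0)"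
      using weight_add_single[of 0 a s "- bag z"] weight_add_single[of 0 b "d - s" "- bag z"]
      by (simp add: weight_add) (simp add: weight_def)
    moreover have "a \<in> - bag z \<or> b \<in> - bag z" using assms(2,3) bag_clique by blast
    ultimately show ?thesis using assms(1) by auto
  qed
  then show "?m \<in> bag_monomials s" by (simp add: bag_monomials_def)
qed

lemma symbolic_power_linear_resolutions:
  fixes J :: "('v, 'k::field) mpoly set"
  assumes simple: "simple_graph E" and adj_E: "\<And>a b. adj a b \<longleftrightarrow> a \<noteq> b \<and> {a, b} \<notin> E"
    and "E \<noteq> {}" and "s \<ge> 1" and J_def: "J = symbolic_power E s"
  shows "d \<le> s \<Longrightarrow> degree_ideal J d = {0}"
    and "degree_ideal J (s + 1) = {0} \<or> has_linear_resolution (degree_ideal J (s + 1)) (s + 1)"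
    and "d \<ge> 2 * s \<Longrightarrow> has_linear_resolution (degree_ideal J d) d"
proof -
  have J: "p \<in> J \<longleftrightarrow> (\<forall>m\<in>keys p. m \<in> bag_monomials s)" for p :: "('v, 'k) mpoly"
    unfolding J_def using simple adj_E by (rule symbolic_power_monomials)
  have zero: "degree_ideal J d = {0}" if "{m \<in> bag_monomials s. mdegree m = d} = {}" for d
    using degree_ideal_monomial[OF J, of d] that by (simp add: module.span_empty[OF module_mult])
  show "degree_ideal J d = {0}" if "d \<le> s"
    by (rule zero) (use bag_monomials_low_degree[OF _ \<open>s \<ge> 1\<close>] that in fastforce)
  show "degree_ideal J (s + 1) = {0} \<or> has_linear_resolution (degree_ideal J (s + 1)) (s + 1)"
  proof -
    obtain ms where ms: "linear_quotients ms" "set ms = {m \<in> bag_monomials s. mdegree m = s + 1}"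
      using independent_linear_quotients[of UNIV "Suc s"] bag_monomials_Suc[of s] by auto
    show ?thesis
    \<comment> \<open>The list is empty when no \<open>s + 1\<close> vertices are independent with
      respect to \<open>adj\<close>.\<close>
    proof (cases "ms = []")
      case True
      then show ?thesis using zero[of "s + 1"] ms(2) by simp
    next
      case False
      then show ?thesis using linear_quotients_has_linear_resolution[OF J ms(1,2)] by blast
    qed
  qed
  show "has_linear_resolution (degree_ideal J d) d" if d: "d \<ge> 2 * s"
  proof -
    obtain ms where ms: "linear_quotients ms" "set ms = {m \<in> bag_monomials s. mdegree m = d}"
      using bag_monomials_linear_quotients[OF d] .
    obtain e where e: "e \<in> E" using \<open>E \<noteq> {}\<close> by blast
    then obtain a b where ab: "e = {a, b}" "a \<noteq> b"
      using simple by (auto simp: simple_graph_def card_2_iff)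
    then have "\<not> adj a b" using e by (simp add: adj_E)
    then have "\<exists>m\<in>bag_monomials s. mdegree m = d"
      using bag_monomials_nonempty[OF d] ab(2) by blast
    then have "ms \<noteq> []" using ms(2) by auto
    then show ?thesis using linear_quotients_has_linear_resolution[OF J ms] by blast
  qed
qed

end

lemma co_chordal_perfect_elimination:
  fixes E :: "'v::finite set set"
  assumes "co_chordal E"
  obtains idx where "perfect_elimination (\<lambda>a b. a \<noteq> b \<and> {a, b} \<notin> E) idx"
proof -
  let ?H = "complement_graph E"
  have H: "chordal_graph ?H"
    using assms by unfold_locales (auto simp: simple_graph_def complement_graph_def co_chordal_def)
  have adj: "chordal_graph.adj ?H u v \<longleftrightarrow> u \<noteq> v \<and> {u, v} \<notin> E" for u v
    unfolding chordal_graph.adj_def[OF H]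
    by (auto simp: complement_graph_def card_2_iff doubleton_eq_iff)
  obtain idx :: "'v \<Rightarrow> nat" where inj: "inj_on idx UNIV"
    and later: "\<forall>u\<in>UNIV. \<forall>v\<in>UNIV. \<forall>w\<in>UNIV. chordal_graph.adj ?H u v \<longrightarrow> chordal_graph.adj ?H u w \<longrightarrow>
      idx u < idx v \<longrightarrow> idx u < idx w \<longrightarrow> v \<noteq> w \<longrightarrow> chordal_graph.adj ?H v w"
    using chordal_graph.exists_perfect_elimination[OF H, of UNIV, OF finite] by (elim exE conjE)
  have "perfect_elimination (\<lambda>a b. a \<noteq> b \<and> {a, b} \<notin> E) idx"
  proof
    show "v \<noteq> w \<and> {v, w} \<notin> E"
      if "u \<noteq> v \<and> {u, v} \<notin> E" "u \<noteq> w \<and> {u, w} \<notin> E" "idx u < idx v" "idx u < idx w" "v \<noteq> w" for u v w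
    proof -
      have "chordal_graph.adj ?H u v" "chordal_graph.adj ?H u w" using that adj by blast+
      then have "chordal_graph.adj ?H v w" using later that by blast
      then show ?thesis using adj by blast
    qed
    show "v \<noteq> u \<and> {v, u} \<notin> E" if "u \<noteq> v \<and> {u, v} \<notin> E" for u v
      using that insert_commute[of u v "{}"] by metis
  qed (use inj in simp_all)
  then show ?thesis by (rule that)
qed

theorem theorem1p2:
  fixes E :: "'n::finite set set" and s :: nat
    and J :: "('n, 'k::field) mpoly set"
  assumes "simple_graph E" and "co_chordal E" and "E \<noteq> {}" and "s \<ge> 1"
    and "J = symbolic_power E s"
  shows "(\<forall>d\<le>s. degree_ideal J d = {0}) \<and>
    (degree_ideal J (s + 1) = {0} \<or> has_linear_resolution (degree_ideal J (s + 1)) (s + 1)) \<and>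
    (\<forall>d\<ge>2 * s. has_linear_resolution (degree_ideal J d) d) \<and>
    (\<forall>d. \<not> (d \<le> s \<or> d = s + 1 \<or> d \<ge> 2 * s) \<longrightarrow> s + 2 \<le> d \<and> d \<le> 2 * s - 1) \<and>
    ({s + 2..2 * s - 1} \<noteq> {} \<longrightarrow> s \<ge> 3)"
proof -
  obtain idx where "perfect_elimination (\<lambda>a b. a \<noteq> b \<and> {a, b} \<notin> E) idx"
    using co_chordal_perfect_elimination[OF assms(2)] .
  note linear = perfect_elimination.symbolic_power_linear_resolutions[OF this assms(1) refl assms(3-5)]
  show ?thesis
  proof (intro conjI allI impI)
    show "degree_ideal J d = {0}" if "d \<le> s" for d using that by (rule linear(1))
    show "degree_ideal J (s + 1) = {0} \<or> has_linear_resolution (degree_ideal J (s + 1)) (s + 1)"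
      by (rule linear(2))
    show "has_linear_resolution (degree_ideal J d) d" if "2 * s \<le> d" for d using that by (rule linear(3))
    show "s + 2 \<le> d" "d \<le> 2 * s - 1" if "\<not> (d \<le> s \<or> d = s + 1 \<or> 2 * s \<le> d)" for d
      using that by linarith+
    show "3 \<le> s" if "{s + 2..2 * s - 1} \<noteq> {}" using that by auto
  qed
qed

end
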